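(* Let $d\ge 1$ be an integer, let $\mathcal{H}\cong\mathbb{C}^d$ be a $d$-dimensional Hilbert space with a fixed orthonormal basis, let $\Theta:\mathsf{L}(\mathcal{H})\to\mathsf{L}(\mathcal{H})$, $\Theta(X)=X^{\mathsf T}$, be the transposition map with respect to this basis, and let $T:\mathsf{L}(\mathcal{H})\to\mathsf{L}(\mathcal{H})$ be a quantum channel. Then $$\left\|\Theta\circ(\mathrm{id}-T)\right\|_{\diamond}\;\le\;\frac{1}{\sqrt2}\,\left\|\Theta\right\|_{\diamond}\,\left\|\mathrm{id}-T\right\|_{\diamond}.$$ In particular, since $\|\Theta\|_\diamond=d$, $$\left\|\Theta\circ(\mathrm{id}-T)\right\|_{\diamond}\;\le\;\frac{d}{\sqrt2}\,\left\|\mathrm{id}-T\right\|_{\diamond}.$$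
   Context: $\mathsf{L}(\mathcal{H})$ denotes the space of linear operators on $\mathcal{H}$, and $\mathsf{D}(\mathcal{H})=\{\rho\in\mathsf{L}(\mathcal{H}):\rho\succeq 0,\ \operatorname{tr}(\rho)=1\}$ the set of density operators. A quantum channel $T:\mathsf{L}(\mathcal{H})\to\mathsf{L}(\mathcal{H})$ is a completely positive trace-preserving linear map; $\mathrm{id}$ is the identity map on $\mathsf{L}(\mathcal{H})$ and $\mathrm{id}_k$ the identity map on $\mathsf{L}(\mathbb{C}^k)$. The trace norm is $\|X\|_1=\operatorname{tr}\sqrt{X^\dagger X}$. The diamond norm of a linear map $\Phi:\mathsf{L}(\mathcal{H})\to\mathsf{L}(\mathcal{H})$ is $$\|\Phi\|_\diamond:=\sup_{k\ge1}\ \sup_{\rho\in\mathsf{D}(\mathcal{H}\otimes\mathbb{C}^k)}\left\|(\Phi\otimes\mathrm{id}_k)(\rho)\right\|_1 .$$ It is standard that for maps on $\mathsf{L}(\mathbb{C}^d)$ the supremum over $k$ can be restricted to $k=d$. It is also known (Tomiyama) that $\|\Theta\|_\diamond=d$. *)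

theory Defs
  imports
    Complex_Main
    "HOL-Library.Extended_Real"
    "Jordan_Normal_Form.Schur_Decomposition"
begin

text \<open>
  Fixing the orthonormal basis, \<open>L(H)\<close> for a \<open>d\<close>-dimensional \<open>H\<close> is \<open>carrier_mat d d\<close> over the
  complex numbers. A map on \<open>L(H)\<close> is a HOL function on matrices; only its values on
  \<open>carrier_mat d d\<close> are ever used.
\<close>

definition mat_trace :: "complex mat \<Rightarrow> complex" where
  "mat_trace A = (\<Sum>i<dim_row A. A $$ (i, i))"

definition psd :: "nat \<Rightarrow> complex mat \<Rightarrow> bool" where
  "psd n A \<longleftrightarrow> A \<in> carrier_mat n n \<and> mat_adjoint A = A \<and>
     (\<forall>v \<in> carrier_vec n. Re ((A *\<^sub>v v) \<bullet>c v) \<ge> 0)"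

definition density_operator :: "nat \<Rightarrow> complex mat \<Rightarrow> bool" where
  "density_operator n \<rho> \<longleftrightarrow> psd n \<rho> \<and> mat_trace \<rho> = 1"

definition psd_sqrt :: "complex mat \<Rightarrow> complex mat" where
  "psd_sqrt A = (THE S. psd (dim_row A) S \<and> S * S = A)"

definition trace_norm :: "complex mat \<Rightarrow> real" where
  "trace_norm X = Re (mat_trace (psd_sqrt (mat_adjoint X * X)))"

definition linear_super :: "nat \<Rightarrow> (complex mat \<Rightarrow> complex mat) \<Rightarrow> bool" where
  "linear_super d \<Phi> \<longleftrightarrow>
     (\<forall>X \<in> carrier_mat d d. \<Phi> X \<in> carrier_mat d d) \<and>
     (\<forall>X \<in> carrier_mat d d. \<forall>Y \<in> carrier_mat d d. \<Phi> (X + Y) = \<Phi> X + \<Phi> Y) \<and>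
     (\<forall>c. \<forall>X \<in> carrier_mat d d. \<Phi> (c \<cdot>\<^sub>m X) = c \<cdot>\<^sub>m \<Phi> X)"

text \<open>
  The basis vector \<open>e_i \<otimes> f_a\<close> (\<open>i < d\<close>, \<open>a < k\<close>) of \<open>H \<otimes> C^k\<close> has index \<open>i * k + a\<close>.
  Writing an operator \<open>\<rho>\<close> on \<open>H \<otimes> C^k\<close> as the sum of the \<open>tensor_block d k \<rho> a b \<otimes> E_ab\<close> with
  matrix units \<open>E_ab\<close>, \<open>\<Phi> \<otimes> id_k\<close> applies \<open>\<Phi>\<close> to every block.
\<close>

definition tensor_block :: "nat \<Rightarrow> nat \<Rightarrow> complex mat \<Rightarrow> nat \<Rightarrow> nat \<Rightarrow> complex mat" where
  "tensor_block d k \<rho> a b = mat d d (\<lambda>(i, j). \<rho> $$ (i * k + a, j * k + b))"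

definition tensor_id ::
  "nat \<Rightarrow> nat \<Rightarrow> (complex mat \<Rightarrow> complex mat) \<Rightarrow> complex mat \<Rightarrow> complex mat" where
  "tensor_id d k \<Phi> \<rho> = mat (d * k) (d * k)
     (\<lambda>(r, s). \<Phi> (tensor_block d k \<rho> (r mod k) (s mod k)) $$ (r div k, s div k))"

definition kron :: "complex mat \<Rightarrow> complex mat \<Rightarrow> complex mat" where
  "kron A B = mat (dim_row A * dim_row B) (dim_col A * dim_col B)
     (\<lambda>(r, s). A $$ (r div dim_row B, s div dim_col B) * B $$ (r mod dim_row B, s mod dim_col B))"

lemma tensor_id_kron:
  assumes \<Phi>: "linear_super d \<Phi>" and A: "A \<in> carrier_mat d d" and B: "B \<in> carrier_mat k k"
  shows "tensor_id d k \<Phi> (kron A B) = kron (\<Phi> A) B"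
proof -
  have \<Phi>A: "\<Phi> A \<in> carrier_mat d d"
    using \<Phi> A by (simp add: linear_super_def)
  have bound: "i * k + a < d * k" if "i < d" "a < k" for i a
  proof -
    have "i * k + a < Suc i * k" using that by simp
    also have "\<dots> \<le> d * k" using that by (intro mult_right_mono) auto
    finally show ?thesis .
  qed
  have block: "tensor_block d k (kron A B) a b = B $$ (a, b) \<cdot>\<^sub>m A" if "a < k" "b < k" for a b
    using that A B by (intro eq_matI) (auto simp: tensor_block_def kron_def bound)
  have \<Phi>_smult: "\<Phi> (c \<cdot>\<^sub>m A) = c \<cdot>\<^sub>m \<Phi> A" for c
    using \<Phi> A by (simp add: linear_super_def)
  show ?thesis
  proof (rule eq_matI)
    fix r s
    assume "r < dim_row (kron (\<Phi> A) B)" and "s < dim_col (kron (\<Phi> A) B)"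
    then have rs: "r < d * k" "s < d * k"
      using \<Phi>A B by (auto simp: kron_def)
    then have "k > 0" by (cases k) auto
    with rs have bnd: "r mod k < k" "s mod k < k" "r div k < d" "s div k < d"
      by (auto simp: less_mult_imp_div_less)
    then have "tensor_id d k \<Phi> (kron A B) $$ (r, s) =
        (B $$ (r mod k, s mod k) \<cdot>\<^sub>m \<Phi> A) $$ (r div k, s div k)"
      using rs by (simp add: tensor_id_def block \<Phi>_smult)
    also have "\<dots> = kron (\<Phi> A) B $$ (r, s)"
      using rs bnd \<Phi>A B by (simp add: kron_def)
    finally show "tensor_id d k \<Phi> (kron A B) $$ (r, s) = kron (\<Phi> A) B $$ (r, s)" .
  qed (use \<Phi>A B in \<open>auto simp: tensor_id_def kron_def\<close>)
qed

definition completely_positive :: "nat \<Rightarrow> (complex mat \<Rightarrow> complex mat) \<Rightarrow> bool" where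
  "completely_positive d \<Phi> \<longleftrightarrow>
     (\<forall>k\<ge>1. \<forall>\<rho>. psd (d * k) \<rho> \<longrightarrow> psd (d * k) (tensor_id d k \<Phi> \<rho>))"

definition trace_preserving :: "nat \<Rightarrow> (complex mat \<Rightarrow> complex mat) \<Rightarrow> bool" where
  "trace_preserving d \<Phi> \<longleftrightarrow> (\<forall>X \<in> carrier_mat d d. mat_trace (\<Phi> X) = mat_trace X)"

definition quantum_channel :: "nat \<Rightarrow> (complex mat \<Rightarrow> complex mat) \<Rightarrow> bool" where
  "quantum_channel d T \<longleftrightarrow> linear_super d T \<and> completely_positive d T \<and> trace_preserving d T"

text \<open>
  The supremum is taken in the extended reals, so that its definition presupposes no boundedness;
  for linear \<open>\<Phi>\<close> it is finite.
\<close>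

definition diamond_norm :: "nat \<Rightarrow> (complex mat \<Rightarrow> complex mat) \<Rightarrow> ereal" where
  "diamond_norm d \<Phi> =
     (SUP k \<in> {1..}. SUP \<rho> \<in> {\<rho>. density_operator (d * k) \<rho>}. ereal (trace_norm (tensor_id d k \<Phi> \<rho>)))"

end

theory Submission
  imports Defs "HOL-Analysis.L2_Norm"
begin

text \<open>
  Let \<open>X = ((id - T) \<otimes> id\<^sub>k)(\<psi>\<psi>\<^sup>*)\<close> for a unit vector \<open>\<psi>\<close>. It is Hermitian and traceless, so its positive
  and negative eigenvalues have equal total weight, and therefore \<open>\<parallel>X\<parallel>\<^sub>2 \<le> \<parallel>X\<parallel>\<^sub>1 / \<surd>2\<close>. The partial
  transposition permutes matrix entries, so it preserves the Hilbert--Schmidt norm; and since the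
  Schmidt rank of \<open>\<psi>\<close> is at most \<open>d\<close>, the partial transpose of \<open>X\<close> has rank at most \<open>d\<^sup>2\<close>, which
  bounds its trace norm by \<open>d \<parallel>X\<parallel>\<^sub>2\<close> for every \<open>k\<close>. Mixed states follow by convexity: the trace norm
  is tested against one eigenbasis of the output, for all pure components at once. Finally
  \<open>\<parallel>\<Theta>\<parallel> \<ge> d\<close> because \<open>\<Theta>\<close> maps the maximally entangled state to the flip operator divided by \<open>d\<close>.
\<close>

subsection \<open>Orthonormal families\<close>

text \<open>Vectors are functions on \<open>nat\<close> of which only the values below
  \<open>n\<close> matter, so no carrier conditions accompany sums and families of vectors.\<close>

definition cinner :: "nat \<Rightarrow> (nat \<Rightarrow> complex) \<Rightarrow> (nat \<Rightarrow> complex) \<Rightarrow> complex" where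
  "cinner n x y = (\<Sum>i<n. cnj (x i) * y i)"

definition orthonormal :: "nat \<Rightarrow> nat \<Rightarrow> (nat \<Rightarrow> nat \<Rightarrow> complex) \<Rightarrow> bool" where
  "orthonormal n m u \<longleftrightarrow> (\<forall>p<m. \<forall>q<m. cinner n (u p) (u q) = of_bool (p = q))"

lemma sum_of_bool_mult [simp]:
  fixes f :: "nat \<Rightarrow> 'a :: semiring_1"
  shows "l < n \<Longrightarrow> (\<Sum>i<n. of_bool (l = i) * f i) = f l"
    and "l < n \<Longrightarrow> (\<Sum>i<n. of_bool (i = l) * f i) = f l"
    and "l < n \<Longrightarrow> (\<Sum>i<n. f i * of_bool (l = i)) = f l"
    and "l < n \<Longrightarrow> (\<Sum>i<n. f i * of_bool (i = l)) = f l"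
proof -
  assume l: "l < n"
  have "of_bool (l = i) * f i = (if i = l then f l else 0)" "of_bool (i = l) * f i = (if i = l then f l else 0)"
    "f i * of_bool (l = i) = (if i = l then f l else 0)" "f i * of_bool (i = l) = (if i = l then f l else 0)" for i
    by auto
  with l show "(\<Sum>i<n. of_bool (l = i) * f i) = f l" "(\<Sum>i<n. of_bool (i = l) * f i) = f l"
    "(\<Sum>i<n. f i * of_bool (l = i)) = f l" "(\<Sum>i<n. f i * of_bool (i = l)) = f l"
    by (simp_all only: sum.delta finite_lessThan lessThan_iff if_True)
qed

lemma sum_lessThan_add:
  fixes g :: "nat \<Rightarrow> 'a :: comm_monoid_add"
  shows "(\<Sum>l<m + N. g l) = (\<Sum>l<m. g l) + (\<Sum>p<N. g (m + p))"
  by (induction N) (simp_all add: add.assoc)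

lemma cnj_cinner: "cnj (cinner n x y) = cinner n y x"
  by (simp add: cinner_def mult.commute)

lemma cinner_cong: "(\<And>i. i < n \<Longrightarrow> x i = x' i) \<Longrightarrow> (\<And>i. i < n \<Longrightarrow> y i = y' i) \<Longrightarrow> cinner n x y = cinner n x' y'"
  by (simp add: cinner_def)

lemma cinner_sum_right: "cinner n x (\<lambda>i. \<Sum>q\<in>I. c q * y q i) = (\<Sum>q\<in>I. c q * cinner n x (y q))"
  unfolding cinner_def sum_distrib_left
  by (subst sum.swap) (simp add: mult_ac)

lemma cinner_diff_right: "cinner n x (\<lambda>i. y i - z i) = cinner n x y - cinner n x z"
  by (simp add: cinner_def algebra_simps sum_subtractf)

lemma cinner_scale_right: "cinner n x (\<lambda>i. c * y i) = c * cinner n x y"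
  by (simp add: cinner_def sum_distrib_left mult_ac)

lemma cinner_self: "cinner n x x = of_real (\<Sum>i<n. (cmod (x i))\<^sup>2)"
  by (simp add: cinner_def complex_norm_square mult.commute del: of_real_power)

lemma cinner_cauchy_schwarz:
  "cmod (cinner n x y) \<le> L2_set (\<lambda>i. cmod (x i)) {..<n} * L2_set (\<lambda>i. cmod (y i)) {..<n}"
proof -
  have "cmod (cinner n x y) \<le> (\<Sum>i<n. cmod (x i) * cmod (y i))"
    unfolding cinner_def by (rule order_trans[OF norm_sum]) (simp add: norm_mult)
  also have "\<dots> \<le> L2_set (\<lambda>i. cmod (x i)) {..<n} * L2_set (\<lambda>i. cmod (y i)) {..<n}"
    using L2_set_mult_ineq[of "\<lambda>i. cmod (x i)" "\<lambda>i. cmod (y i)" "{..<n}"] by simp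
  finally show ?thesis .
qed

lemma exists_normalization:
  fixes x :: "nat \<Rightarrow> complex"
  assumes "i < n" "x i \<noteq> 0"
  obtains s :: real where "s > 0" "cinner n (\<lambda>i. x i / s) (\<lambda>i. x i / s) = 1" "cinner n x x = s\<^sup>2"
proof -
  define t where "t = (\<Sum>i<n. (cmod (x i))\<^sup>2)"
  have "t > 0" unfolding t_def
    by (rule sum_pos2[of _ i]) (use assms in auto)
  have xx: "cinner n x x = of_real t" by (simp only: cinner_self t_def)
  have "cinner n (\<lambda>i. x i / sqrt t) (\<lambda>i. x i / sqrt t) = cinner n x x / of_real ((sqrt t)\<^sup>2)"
    unfolding cinner_def sum_divide_distrib by (intro sum.cong refl) (simp only: power2_eq_square of_real_mult complex_cnj_divide complex_cnj_complex_of_real times_divide_times_eq)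
  also have "\<dots> = 1" using \<open>t > 0\<close> by (simp add: xx)
  finally show ?thesis using \<open>t > 0\<close> xx by (intro that[of "sqrt t"]) simp_all
qed

lemma orthonormal_snoc:
  assumes "orthonormal n m u" "\<And>p. p < m \<Longrightarrow> cinner n (u p) w = 0" "cinner n w w = 1"
  shows "orthonormal n (Suc m) (u(m := w))"
proof -
  have "cinner n w (u p) = 0" if "p < m" for p
    using assms(2)[OF that] cnj_cinner[of n "u p" w] by simp
  then show ?thesis using assms by (auto simp: orthonormal_def less_Suc_eq)
qed

definition proj :: "nat \<Rightarrow> nat \<Rightarrow> (nat \<Rightarrow> nat \<Rightarrow> complex) \<Rightarrow> (nat \<Rightarrow> complex) \<Rightarrow> nat \<Rightarrow> complex" where
  "proj n m u v i = (\<Sum>q<m. cinner n (u q) v * u q i)"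

lemma cinner_proj:
  assumes "orthonormal n m u" "p < m"
  shows "cinner n (u p) (proj n m u v) = cinner n (u p) v"
proof -
  have "cinner n (u p) (proj n m u v) = (\<Sum>q<m. cinner n (u q) v * cinner n (u p) (u q))"
    unfolding proj_def by (rule cinner_sum_right)
  also have "\<dots> = (\<Sum>q<m. cinner n (u q) v * of_bool (p = q))"
    using assms by (intro sum.cong) (auto simp: orthonormal_def)
  also have "\<dots> = cinner n (u p) v" using assms by simp
  finally show ?thesis .
qed

text \<open>Gram-Schmidt step: the residual \<open>r\<close> of \<open>v\<close> is orthogonal to
  the given vectors and nonzero at \<open>i\<close>, so it can be normalised to \<open>w\<close>;
  then \<open>v\<close> lies in the enlarged span.\<close>

lemma orthonormal_extend:
  fixes v :: "nat \<Rightarrow> complex"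
  assumes u: "orthonormal n m u" and i: "i < n" "v i \<noteq> proj n m u v i"
  obtains w where "orthonormal n (Suc m) (u(m := w))"
    "\<And>j. proj n (Suc m) (u(m := w)) v j = v j"
proof -
  define r :: "nat \<Rightarrow> complex" where "r j = v j - proj n m u v j" for j
  have "r i \<noteq> 0" using i by (simp add: r_def)
  from exists_normalization[of i n r, OF i(1) this] obtain s :: real where s: "s > 0"
    "cinner n (\<lambda>i. r i / s) (\<lambda>i. r i / s) = 1" "cinner n r r = s\<^sup>2" by blast
  have ur: "cinner n (u p) r = 0" if "p < m" for p
    using cinner_proj[OF u that, of v] unfolding r_def by (simp add: cinner_diff_right)
  have ru: "cinner n r (u p) = 0" if "p < m" for p
    using ur[OF that] cnj_cinner[of n "u p" r] by simp
  let ?w = "\<lambda>i. r i / s"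
  have uw: "cinner n (u p) ?w = 0" if "p < m" for p
    using cinner_scale_right[of n "u p" "1 / s" r] ur[OF that] by simp
  have "cinner n r (proj n m u v) = (\<Sum>q<m. cinner n (u q) v * cinner n r (u q))"
    unfolding proj_def by (rule cinner_sum_right)
  also have "\<dots> = 0" using ru by simp
  \<comment> \<open>The residual is orthogonal to the projection, so the coefficient of
    \<open>v\<close> along the new vector is the norm \<open>s\<close> of \<open>r\<close>, which
    restores exactly what the old projection misses.\<close>
  finally have "cinner n r v = cinner n r r"
    using cinner_diff_right[of n r v "proj n m u v"] by (simp add: r_def[abs_def])
  moreover have "cinner n ?w v = cinner n r v / s"
    by (simp add: cinner_def sum_divide_distrib)
  ultimately have "cinner n ?w v = s" using s by (simp add: power2_eq_square)
  then have "proj n (Suc m) (u(m := ?w)) v j = v j" for j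
    using s(1) by (simp add: proj_def r_def)
  with orthonormal_snoc[OF u uw s(2)] show ?thesis by (rule that)
qed

text \<open>For square matrices a left inverse is also a right inverse, which turns orthonormality
  of the columns into the resolution of the identity.\<close>

lemma orthonormal_complete:
  assumes u: "orthonormal n n u" and "i < n" "j < n"
  shows "(\<Sum>l<n. u l i * cnj (u l j)) = of_bool (i = j)"
proof -
  let ?U = "mat n n (\<lambda>(i, l). u l i)" and ?V = "mat n n (\<lambda>(l, i). cnj (u l i))"
  have "?V * ?U = 1\<^sub>m n"
    using u by (intro eq_matI) (auto simp: scalar_prod_def orthonormal_def cinner_def lessThan_atLeast0)
  then have "?U * ?V = 1\<^sub>m n"
    by (intro mat_mult_left_right_inverse[of ?V n ?U]) auto
  then have "(?U * ?V) $$ (i, j) = of_bool (i = j)" using assms by simp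
  then show ?thesis using assms by (simp add: scalar_prod_def lessThan_atLeast0)
qed

lemma proj_complete:
  assumes u: "orthonormal n n u" and "i < n"
  shows "proj n n u v i = v i"
proof -
  have "proj n n u v i = (\<Sum>j<n. (\<Sum>l<n. u l i * cnj (u l j)) * v j)"
    unfolding proj_def cinner_def sum_distrib_right by (subst sum.swap) (simp add: mult_ac)
  also have "\<dots> = (\<Sum>j<n. of_bool (i = j) * v j)"
    using orthonormal_complete[OF u \<open>i < n\<close>] by simp
  finally show ?thesis using assms by simp
qed

lemma parseval:
  assumes u: "orthonormal n n u"
  shows "(\<Sum>l<n. (cmod (cinner n (u l) x))\<^sup>2) = (\<Sum>i<n. (cmod (x i))\<^sup>2)"
proof -
  have "cinner n x x = cinner n x (proj n n u x)"
    using proj_complete[OF u] by (intro cinner_cong) auto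
  also have "\<dots> = (\<Sum>l<n. cinner n (u l) x * cinner n x (u l))"
    unfolding proj_def by (rule cinner_sum_right)
  also have "\<dots> = (\<Sum>l<n. of_real ((cmod (cinner n (u l) x))\<^sup>2))"
    unfolding complex_norm_square by (simp add: cnj_cinner)
  finally have "complex_of_real (\<Sum>l<n. (cmod (cinner n (u l) x))\<^sup>2) = of_real (\<Sum>i<n. (cmod (x i))\<^sup>2)"
    by (simp only: cinner_self of_real_sum)
  then show ?thesis by (simp only: of_real_eq_iff)
qed

text \<open>Vectors are added one at a time. If every standard basis vector were fixed by the
  projection, its trace would be both \<open>n\<close> and \<open>m\<close>; so for
  \<open>m < n\<close> some standard basis vector extends the family.\<close>

lemma orthonormal_completion:
  assumes "orthonormal n m u" "m \<le> n"
  obtains b where "orthonormal n n b" "\<And>q. q < m \<Longrightarrow> b q = u q"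
proof -
  have "\<exists>b. orthonormal n n b \<and> (\<forall>q<m. b q = u q)"
    using assms(2,1)
  proof (induction m arbitrary: u rule: inc_induct)
    case base
    then show ?case by blast
  next
    case (step m)
    let ?e = "\<lambda>a i. of_bool (i = a) :: complex"
    have "\<exists>a<n. \<exists>i<n. ?e a i \<noteq> proj n m u (?e a) i"
    proof (rule ccontr)
      assume "\<not> ?thesis"
      then have "(\<Sum>a<n. proj n m u (?e a) a) = (\<Sum>a<n. 1)"
        by (intro sum.cong) force+
      moreover have "proj n m u (?e a) a = (\<Sum>q<m. cnj (u q a) * u q a)" if "a < n" for a
        using that by (simp add: proj_def cinner_def)
      then have "(\<Sum>a<n. proj n m u (?e a) a) = (\<Sum>a<n. \<Sum>q<m. cnj (u q a) * u q a)" by simp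
      also have "\<dots> = (\<Sum>q<m. cinner n (u q) (u q))"
        unfolding cinner_def by (rule sum.swap)
      also have "\<dots> = of_nat m" using step.prems by (simp add: orthonormal_def)
      ultimately have "of_nat m = (of_nat n :: complex)" by simp
      then show False using step.hyps by simp
    qed
    then obtain a i where ai: "i < n" "?e a i \<noteq> proj n m u (?e a) i" by blast
    obtain w where "orthonormal n (Suc m) (u(m := w))"
      by (rule orthonormal_extend[OF step.prems ai])
    from step.IH[OF this] show ?case by (metis fun_upd_apply less_SucI less_irrefl)
  qed
  then show ?thesis using that by blast
qed

section \<open>Eigenvectors of Hermitian matrices\<close>

lemma exists_eigenvector_fun:
  fixes A :: "nat \<Rightarrow> nat \<Rightarrow> complex"
  assumes "n > 0"
  obtains x \<mu> i where "i < n" "x i \<noteq> 0" "\<And>i. i < n \<Longrightarrow> (\<Sum>j<n. A i j * x j) = \<mu> * x i"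
proof -
  let ?M = "mat n n (\<lambda>(i, j). A i j)"
  have M: "?M \<in> carrier_mat n n" by simp
  obtain as where "char_poly ?M = (\<Prod>a\<leftarrow>as. [:- a, 1:])" "length as = n"
    using char_poly_factorized[OF M] by blast
  then obtain \<mu> where "poly (char_poly ?M) \<mu> = 0"
    using assms by (cases as) (auto simp: poly_prod_list)
  then obtain v where v: "eigenvector ?M v \<mu>"
    using eigenvalue_root_char_poly[OF M] by (auto simp: eigenvalue_def)
  then have v': "v \<in> carrier_vec n" "v \<noteq> 0\<^sub>v n" "?M *\<^sub>v v = \<mu> \<cdot>\<^sub>v v"
    by (auto simp: eigenvector_def)
  then obtain i where "i < n" "v $ i \<noteq> 0" by (metis carrier_vecD eq_vecI index_zero_vec)
  moreover have "(\<Sum>j<n. A i j * v $ j) = \<mu> * v $ i" if "i < n" for i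
  proof -
    have "(?M *\<^sub>v v) $ i = \<mu> * v $ i" using v' that by simp
    then show ?thesis using v'(1) that by (simp add: scalar_prod_def lessThan_atLeast0)
  qed
  ultimately show ?thesis using that[of i "\<lambda>i. v $ i"] by blast
qed

definition hermitian_fun :: "nat \<Rightarrow> (nat \<Rightarrow> nat \<Rightarrow> complex) \<Rightarrow> bool" where
  "hermitian_fun n A \<longleftrightarrow> (\<forall>i<n. \<forall>j<n. cnj (A j i) = A i j)"

definition app :: "nat \<Rightarrow> (nat \<Rightarrow> nat \<Rightarrow> complex) \<Rightarrow> (nat \<Rightarrow> complex) \<Rightarrow> nat \<Rightarrow> complex" where
  "app n A x i = (\<Sum>j<n. A i j * x j)"

lemma cinner_hermitian:
  assumes "hermitian_fun n A"
  shows "cinner n x (app n A y) = cinner n (app n A x) y"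
proof -
  have "cinner n x (app n A y) = (\<Sum>i<n. \<Sum>j<n. A i j * cnj (x i) * y j)"
    by (simp add: cinner_def app_def sum_distrib_left mult_ac)
  also have "\<dots> = (\<Sum>i<n. \<Sum>j<n. cnj (A j i) * cnj (x i) * y j)"
    using assms unfolding hermitian_fun_def by (intro sum.cong refl) (metis lessThan_iff)
  also have "\<dots> = cinner n (app n A x) y"
    unfolding cinner_def app_def cnj_sum sum_distrib_right by (subst sum.swap) simp
  finally show ?thesis .
qed

lemma app_sum: "app n A (\<lambda>i. \<Sum>q\<in>I. c q * y q i) i = (\<Sum>q\<in>I. c q * app n A (y q) i)"
  unfolding app_def sum_distrib_left by (subst sum.swap) (simp add: mult_ac)

lemma cinner_sum_left: "cinner n (\<lambda>i. \<Sum>q\<in>I. c q * y q i) x = (\<Sum>q\<in>I. cnj (c q) * cinner n (y q) x)"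
  unfolding cinner_def cnj_sum sum_distrib_left sum_distrib_right
  by (subst sum.swap) (simp add: mult_ac)

text \<open>The new eigenvector is found in the compression of \<open>A\<close> to the orthogonal complement of
  the given eigenvectors, which is invariant under \<open>A\<close>.\<close>

lemma hermitian_eigenvector_extend:
  fixes f :: "nat \<Rightarrow> real" and u :: "nat \<Rightarrow> nat \<Rightarrow> complex"
  assumes A: "hermitian_fun n A" and u: "orthonormal n m u" and m: "m < n"
    and ev: "\<And>q i. q < m \<Longrightarrow> i < n \<Longrightarrow> app n A (u q) i = f q * u q i"
  obtains w :: "nat \<Rightarrow> complex" and \<mu> :: real where "orthonormal n (Suc m) (u(m := w))"
    "\<And>i. i < n \<Longrightarrow> app n A w i = \<mu> * w i"
proof -
  obtain b where b: "orthonormal n n b" and bu: "\<And>q. q < m \<Longrightarrow> b q = u q"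
    using orthonormal_completion[OF u less_imp_le[OF m]] by blast
  define N where "N = n - m"
  have n: "n = m + N" and N: "N > 0" using m by (auto simp: N_def)
  obtain x \<mu> p0 where p0: "p0 < N" "x p0 \<noteq> 0"
    and x: "\<And>p. p < N \<Longrightarrow> (\<Sum>q<N. cinner n (b (m + p)) (app n A (b (m + q))) * x q) = \<mu> * x p"
    by (rule exists_eigenvector_fun[OF N, of "\<lambda>p q. cinner n (b (m + p)) (app n A (b (m + q)))"]) blast
  \<comment> \<open>\<open>x\<close> holds coordinates in the basis of the orthogonal complement;
    \<open>v\<close> is the same vector in the full space.\<close>
  define v :: "nat \<Rightarrow> complex" where "v i = (\<Sum>q<N. x q * b (m + q) i)" for i
  have bv: "cinner n (b l) v = (\<Sum>q<N. x q * of_bool (l = m + q))" if "l < n" for l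
    unfolding v_def cinner_sum_right
    using b that n by (intro sum.cong) (auto simp: orthonormal_def)
  have bv0: "cinner n (b l) v = 0" if "l < m" for l
    using bv[of l] that m by simp
  have bvp: "cinner n (b (m + p)) v = x p" if "p < N" for p
    using bv[of "m + p"] that n by simp
  \<comment> \<open>Hermiticity moves \<open>A\<close> onto the eigenvector \<open>b l\<close>,
    which it only rescales, so \<open>A v\<close> stays orthogonal to \<open>b l\<close>.\<close>
  have bAv0: "cinner n (b l) (app n A v) = 0" if "l < m" for l
  proof -
    have "cinner n (b l) (app n A v) = cinner n (\<lambda>i. f l * b l i) v"
      unfolding cinner_hermitian[OF A] using ev that bu by (intro cinner_cong) auto
    also have "\<dots> = f l * cinner n (b l) v"
      by (simp add: cinner_def sum_distrib_left mult_ac)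
    finally show ?thesis using bv0[OF that] by simp
  qed
  have bAvp: "cinner n (b (m + p)) (app n A v) = \<mu> * x p" if "p < N" for p
  proof -
    have "cinner n (b (m + p)) (app n A v) =
        cinner n (b (m + p)) (\<lambda>i. \<Sum>q<N. x q * app n A (b (m + q)) i)"
      unfolding v_def by (intro cinner_cong) (simp_all add: app_sum)
    then show ?thesis using x[OF that] by (simp add: cinner_sum_right mult.commute)
  qed
  have Av: "app n A v i = \<mu> * v i" if "i < n" for i
  proof -
    have "app n A v i = (\<Sum>l<m + N. cinner n (b l) (app n A v) * b l i)"
      using proj_complete[OF b that, of "app n A v"] n by (simp add: proj_def)
    also have "\<dots> = (\<Sum>p<N. \<mu> * x p * b (m + p) i)"
      by (simp add: sum_lessThan_add bAv0 bAvp)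
    also have "\<dots> = \<mu> * v i" by (simp add: v_def sum_distrib_left mult_ac)
    finally show ?thesis .
  qed
  have "\<exists>i<n. v i \<noteq> 0"
  proof (rule ccontr)
    assume "\<not> ?thesis"
    then have "cinner n (b (m + p0)) v = 0" by (simp add: cinner_def)
    then show False using bvp p0 by simp
  qed
  then obtain i where "i < n" "v i \<noteq> 0" by blast
  from exists_normalization[of i n v, OF this] obtain s :: real
    where s: "s > 0" "cinner n (\<lambda>i. v i / s) (\<lambda>i. v i / s) = 1" by blast
  let ?w = "\<lambda>i. v i / s"
  have "cinner n (u p) ?w = 0" if "p < m" for p
    using cinner_scale_right[of n "u p" "1 / s" v] bv0[OF that] bu[OF that] by simp
  then have on: "orthonormal n (Suc m) (u(m := ?w))"
    by (intro orthonormal_snoc[OF u _ s(2)])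
  have Aw: "app n A ?w i = \<mu> * ?w i" if "i < n" for i
    using Av[OF that] s(1) by (simp add: app_def sum_divide_distrib[symmetric])
  have "cinner n ?w (app n A ?w) = cinner n ?w (\<lambda>i. \<mu> * ?w i)"
    using Aw by (intro cinner_cong) auto
  then have 1: "cinner n ?w (app n A ?w) = \<mu>" using s(2) by (simp only: cinner_scale_right mult_1_right)
  have "cnj (cinner n ?w (app n A ?w)) = cinner n ?w (app n A ?w)"
    using cinner_hermitian[OF A] cnj_cinner by metis
  then have "\<mu> = of_real (Re \<mu>)" unfolding 1 by (metis Reals_cnj_iff of_real_Re)
  then show ?thesis using that[of ?w "Re \<mu>"] on Aw by metis
qed

lemma hermitian_eigenbasis:
  assumes A: "hermitian_fun n A"
  obtains u :: "nat \<Rightarrow> nat \<Rightarrow> complex" and f :: "nat \<Rightarrow> real" where "orthonormal n n u"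
    "\<And>l i. l < n \<Longrightarrow> i < n \<Longrightarrow> app n A (u l) i = f l * u l i"
proof -
  have "\<exists>u :: nat \<Rightarrow> nat \<Rightarrow> complex. \<exists>f :: nat \<Rightarrow> real. orthonormal n m u \<and> (\<forall>l<m. \<forall>i<n. app n A (u l) i = f l * u l i)"
    if "m \<le> n" for m
    using that
  proof (induction m)
    case 0
    then show ?case by (simp add: orthonormal_def)
  next
    case (Suc m)
    then obtain u :: "nat \<Rightarrow> nat \<Rightarrow> complex" and f :: "nat \<Rightarrow> real" where u: "orthonormal n m u"
      and ev: "\<And>l i. l < m \<Longrightarrow> i < n \<Longrightarrow> app n A (u l) i = f l * u l i" by force
    obtain w :: "nat \<Rightarrow> complex" and \<mu> :: real where "orthonormal n (Suc m) (u(m := w))"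
      "\<And>i. i < n \<Longrightarrow> app n A w i = \<mu> * w i"
      using hermitian_eigenvector_extend[OF A u _ ev] Suc.prems by auto
    with ev show ?case
      by (intro exI[of _ "u(m := w)"] exI[of _ "f(m := \<mu>)"] conjI) (simp_all add: less_Suc_eq del: fun_upd_apply, auto)
  qed
  from this[OF order_refl] that show ?thesis by blast
qed

section \<open>Passage between matrices and their entry functions\<close>

abbreviation ent :: "complex mat \<Rightarrow> nat \<Rightarrow> nat \<Rightarrow> complex" where
  "ent A \<equiv> \<lambda>i j. A $$ (i, j)"

lemma mat_adjoint_carrier: "A \<in> carrier_mat n m \<Longrightarrow> mat_adjoint A \<in> carrier_mat m n"
  unfolding mat_adjoint_def by auto

lemma mat_adjoint_index:
  "A \<in> carrier_mat n m \<Longrightarrow> i < m \<Longrightarrow> j < n \<Longrightarrow> mat_adjoint A $$ (i, j) = cnj (A $$ (j, i))"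
  unfolding mat_adjoint_def by (auto simp: mat_of_rows_index)

lemma mat_adjoint_eq_iff:
  assumes A: "A \<in> carrier_mat n n"
  shows "mat_adjoint A = A \<longleftrightarrow> hermitian_fun n (ent A)"
proof
  assume "mat_adjoint A = A"
  then show "hermitian_fun n (ent A)"
    using mat_adjoint_index[OF A] unfolding hermitian_fun_def by metis
next
  assume "hermitian_fun n (ent A)"
  then show "mat_adjoint A = A"
    using A mat_adjoint_carrier[OF A] unfolding hermitian_fun_def
    by (intro eq_matI) (auto simp: mat_adjoint_index[OF A])
qed

lemma psdI:
  assumes "A \<in> carrier_mat n n" "hermitian_fun n (ent A)"
    "\<And>x. Re (cinner n x (app n (ent A) x)) \<ge> 0"
  shows "psd n A"
proof -
  have "(A *\<^sub>v v) \<bullet>c v = cinner n (($) v) (app n (ent A) (($) v))" if "v \<in> carrier_vec n" for v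
    using assms(1) that by (auto simp: cinner_def app_def scalar_prod_def lessThan_atLeast0 mult.commute)
  then show ?thesis using assms by (simp add: psd_def mat_adjoint_eq_iff)
qed

lemma psdD:
  assumes "psd n A"
  shows "A \<in> carrier_mat n n" "hermitian_fun n (ent A)"
    "Re (cinner n x (app n (ent A) x)) \<ge> 0"
proof -
  show A: "A \<in> carrier_mat n n" using assms by (simp add: psd_def)
  then show "hermitian_fun n (ent A)" using assms by (simp add: psd_def mat_adjoint_eq_iff)
  have "(A *\<^sub>v vec n x) \<bullet>c vec n x = cinner n x (app n (ent A) x)"
    using A by (auto simp: cinner_def app_def scalar_prod_def lessThan_atLeast0 mult.commute)
  then show "Re (cinner n x (app n (ent A) x)) \<ge> 0"
    using assms vec_carrier[of n x] unfolding psd_def by metis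
qed

lemma app_mult:
  assumes "A \<in> carrier_mat n n" "B \<in> carrier_mat n n" "i < n"
  shows "app n (ent (A * B)) x i = app n (ent A) (app n (ent B) x) i"
proof -
  have "app n (ent (A * B)) x i = (\<Sum>j<n. \<Sum>t<n. A $$ (i, t) * B $$ (t, j) * x j)"
    using assms by (simp add: app_def scalar_prod_def lessThan_atLeast0 sum_distrib_right)
  also have "\<dots> = app n (ent A) (app n (ent B) x) i"
    unfolding app_def sum_distrib_left by (subst sum.swap) (simp add: mult_ac)
  finally show ?thesis .
qed

subsection \<open>Spectral decomposition and the trace norm\<close>

text \<open>For an orthonormal basis \<open>u\<close> this is the operator with eigenvectors
  \<open>u l\<close> and eigenvalues \<open>f l\<close>; taking \<open>f\<close> real builds
  Hermiticity into the notation.\<close>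

definition spec_mat :: "nat \<Rightarrow> (nat \<Rightarrow> nat \<Rightarrow> complex) \<Rightarrow> (nat \<Rightarrow> real) \<Rightarrow> complex mat" where
  "spec_mat n u f = mat n n (\<lambda>(i, j). \<Sum>l<n. f l * u l i * cnj (u l j))"

lemma spec_mat_carrier [simp]: "spec_mat n u f \<in> carrier_mat n n"
  by (simp add: spec_mat_def)

lemma spec_mat_dim [simp]: "dim_row (spec_mat n u f) = n" "dim_col (spec_mat n u f) = n"
  by (simp_all add: spec_mat_def)

lemma spec_mat_index: "i < n \<Longrightarrow> j < n \<Longrightarrow> spec_mat n u f $$ (i, j) = (\<Sum>l<n. f l * u l i * cnj (u l j))"
  by (simp add: spec_mat_def)

lemma app_spec_mat: "i < n \<Longrightarrow> app n (ent (spec_mat n u f)) x i = (\<Sum>l<n. f l * cinner n (u l) x * u l i)"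
  unfolding app_def cinner_def
  by (simp add: spec_mat_index sum_distrib_left sum_distrib_right mult_ac) (rule sum.swap)

lemma hermitian_spec_mat: "hermitian_fun n (ent (spec_mat n u f))"
  by (simp add: hermitian_fun_def spec_mat_index mult_ac)

lemma psd_spec_mat:
  assumes "\<And>l. l < n \<Longrightarrow> f l \<ge> 0"
  shows "psd n (spec_mat n u f)"
proof (rule psdI)
  fix x
  have "cinner n x (app n (ent (spec_mat n u f)) x) = cinner n x (\<lambda>i. \<Sum>l<n. f l * cinner n (u l) x * u l i)"
    by (intro cinner_cong refl app_spec_mat)
  also have "\<dots> = (\<Sum>l<n. f l * (cinner n (u l) x * cnj (cinner n (u l) x)))"
    unfolding cinner_sum_right by (simp add: cnj_cinner mult.assoc)
  also have "\<dots> = of_real (\<Sum>l<n. f l * (cmod (cinner n (u l) x))\<^sup>2)"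
    by (simp add: complex_norm_square del: of_real_power)
  finally show "0 \<le> Re (cinner n x (app n (ent (spec_mat n u f)) x))"
    using assms by (auto intro!: sum_nonneg simp del: of_real_sum)
qed (simp_all add: hermitian_spec_mat)

text \<open>Orthonormality kills the cross terms. This is the functional calculus in a fixed
  eigenbasis: squares and square roots act on the eigenvalues alone.\<close>

lemma spec_mat_mult:
  assumes u: "orthonormal n n u"
  shows "spec_mat n u f * spec_mat n u g = spec_mat n u (\<lambda>l. f l * g l)"
proof (rule eq_matI)
  fix i j assume "i < dim_row (spec_mat n u (\<lambda>l. f l * g l))" "j < dim_col (spec_mat n u (\<lambda>l. f l * g l))"
  then have ij: "i < n" "j < n" by simp_all
  have "(spec_mat n u f * spec_mat n u g) $$ (i, j) =
      app n (ent (spec_mat n u f)) (\<lambda>t. spec_mat n u g $$ (t, j)) i"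
    using ij by (simp add: scalar_prod_def app_def lessThan_atLeast0)
  also have "\<dots> = (\<Sum>l<n. f l * cinner n (u l) (\<lambda>t. \<Sum>m<n. g m * cnj (u m j) * u m t) * u l i)"
    using ij by (simp add: app_spec_mat cinner_def spec_mat_index mult_ac)
  also have "\<dots> = (\<Sum>l<n. f l * (\<Sum>m<n. g m * cnj (u m j) * of_bool (l = m)) * u l i)"
    using u unfolding cinner_sum_right by (intro sum.cong refl) (simp add: orthonormal_def)
  also have "\<dots> = (\<Sum>l<n. f l * (g l * cnj (u l j)) * u l i)" by simp
  also have "\<dots> = spec_mat n u (\<lambda>l. f l * g l) $$ (i, j)"
    using ij by (simp add: spec_mat_index mult_ac)
  finally show "(spec_mat n u f * spec_mat n u g) $$ (i, j) = spec_mat n u (\<lambda>l. f l * g l) $$ (i, j)" .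
qed simp_all

lemma trace_spec_mat:
  assumes u: "orthonormal n n u"
  shows "mat_trace (spec_mat n u f) = of_real (\<Sum>l<n. f l)"
proof -
  have "mat_trace (spec_mat n u f) = (\<Sum>i<n. \<Sum>l<n. f l * (cnj (u l i) * u l i))"
    by (simp add: mat_trace_def spec_mat_index mult_ac)
  also have "\<dots> = (\<Sum>l<n. f l * cinner n (u l) (u l))"
    unfolding cinner_def sum_distrib_left by (rule sum.swap)
  also have "\<dots> = of_real (\<Sum>l<n. f l)" using u by (simp add: orthonormal_def)
  finally show ?thesis .
qed

text \<open>Completeness writes the \<open>j\<close>-th standard basis vector as a combination of
  eigenvectors; applying \<open>A\<close> to it gives column \<open>j\<close> of the
  expansion.\<close>

lemma spectral_theorem:
  assumes A: "A \<in> carrier_mat n n" "hermitian_fun n (ent A)"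
  obtains u f where "orthonormal n n u" "A = spec_mat n u f"
proof -
  obtain u :: "nat \<Rightarrow> nat \<Rightarrow> complex" and f :: "nat \<Rightarrow> real" where u: "orthonormal n n u"
    and ev: "\<And>l i. l < n \<Longrightarrow> i < n \<Longrightarrow> app n (ent A) (u l) i = f l * u l i"
    by (rule hermitian_eigenbasis[OF A(2)]) (rule that)
  have "A = spec_mat n u f"
  proof (rule eq_matI)
    fix i j assume "i < dim_row (spec_mat n u f)" "j < dim_col (spec_mat n u f)"
    then have ij: "i < n" "j < n" by simp_all
    have "A $$ (i, j) = (\<Sum>t<n. A $$ (i, t) * of_bool (t = j))" using ij by simp
    also have "\<dots> = app n (ent A) (\<lambda>t. \<Sum>l<n. cnj (u l j) * u l t) i"
      unfolding app_def using orthonormal_complete[OF u] ij by (intro sum.cong) (auto simp: mult.commute)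
    also have "\<dots> = spec_mat n u f $$ (i, j)"
      unfolding app_sum using ij ev by (simp add: spec_mat_index mult_ac)
    finally show "A $$ (i, j) = spec_mat n u f $$ (i, j)" .
  qed (use A in auto)
  with u that show ?thesis by blast
qed

text \<open>Uniqueness of the positive square root, which the definite description in
  \<open>psd_sqrt\<close> requires. On a unit eigenvector of \<open>S - R\<close> with eigenvalue
  \<open>f l\<close>, equality of the squares forces \<open>f l = 0\<close> or makes the
  expectations of \<open>S\<close> and \<open>R\<close> sum to zero; both are nonnegative, so they
  vanish, and so does their difference \<open>f l\<close>.\<close>

lemma psd_square_inject:
  assumes S: "psd n S" and R: "psd n R" and eq: "S * S = R * R"
  shows "S = R"
proof -
  note S' = psdD[OF S] and R' = psdD[OF R]
  have "hermitian_fun n (ent (S - R))"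
    using S'(1,2) R'(1,2) by (auto simp: hermitian_fun_def)
  then obtain u f where u: "orthonormal n n u" and D: "S - R = spec_mat n u f"
    using spectral_theorem[OF minus_carrier_mat[OF R'(1)]] by blast
  have "f l = 0" if l: "l < n" for l
  proof -
    let ?s = "app n (ent S) (u l)" and ?r = "app n (ent R) (u l)"
    have D': "?s i - ?r i = f l * u l i" if "i < n" for i
    proof -
      have "?s i - ?r i = app n (ent (S - R)) (u l) i"
        using S'(1) R'(1) that by (simp add: app_def sum_subtractf algebra_simps)
      also have "\<dots> = (\<Sum>m<n. (f m * u m i) * of_bool (m = l))"
        unfolding D app_spec_mat[OF that]
        using l u by (intro sum.cong refl) (simp add: orthonormal_def)
      finally show ?thesis using l by simp
    qed
    have sr: "cinner n x ?s - cinner n x ?r = f l * cinner n x (u l)" for x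
      unfolding cinner_diff_right[symmetric] cinner_scale_right[symmetric]
      using D' by (intro cinner_cong) auto
    have uu: "cinner n (u l) (u l) = 1" using u l by (simp add: orthonormal_def)
    have sq: "cinner n ?s ?s = cinner n (u l) (app n (ent (S * S)) (u l))"
      unfolding cinner_hermitian[OF S'(2), symmetric]
      using app_mult[OF S'(1) S'(1)] by (intro cinner_cong) auto
    have rq: "cinner n ?r ?r = cinner n (u l) (app n (ent (R * R)) (u l))"
      unfolding cinner_hermitian[OF R'(2), symmetric]
      using app_mult[OF R'(1) R'(1)] by (intro cinner_cong) auto
    \<comment> \<open>The splitting is \<open>S S - R R = S (S - R) + (S - R) R\<close>, taken in
      expectation at \<open>u l\<close>.\<close>
    have "0 = cinner n ?s ?s - cinner n ?r ?r" using sq rq eq by simp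
    also have "\<dots> = (cinner n ?s ?s - cinner n ?s ?r) + (cinner n ?s ?r - cinner n ?r ?r)" by simp
    also have "cinner n ?s ?r - cinner n ?r ?r = cnj (cinner n ?r ?s - cinner n ?r ?r)"
      by (simp add: cnj_cinner)
    also have "(cinner n ?s ?s - cinner n ?s ?r) + \<dots> = f l * (cinner n ?s (u l) + cinner n (u l) ?r)"
      unfolding sr by (simp add: cnj_cinner distrib_left)
    also have "cinner n ?s (u l) = cinner n (u l) ?s"
      using cinner_hermitian[OF S'(2)] by simp
    finally have "f l = 0 \<or> cinner n (u l) ?s + cinner n (u l) ?r = 0" by simp
    then have "f l = 0 \<or> Re (cinner n (u l) ?s) + Re (cinner n (u l) ?r) = 0"
      by (auto simp: complex_eq_iff)
    moreover have "Re (cinner n (u l) ?s) - Re (cinner n (u l) ?r) = f l"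
      using arg_cong[OF sr[of "u l"], of Re] uu by simp
    ultimately show ?thesis using S'(3)[of "u l"] R'(3)[of "u l"] by linarith
  qed
  then have "(S - R) $$ (i, j) = 0" if "i < n" "j < n" for i j
    unfolding D using that by (simp add: spec_mat_index)
  then show ?thesis using S'(1) R'(1) by (intro eq_matI) auto
qed

lemma psd_sqrt_eqI:
  assumes "psd n S" "S * S = A"
  shows "psd_sqrt A = S"
proof -
  have n: "dim_row A = n" using psdD(1)[OF assms(1)] assms(2) by auto
  show ?thesis unfolding psd_sqrt_def n
    using assms psd_square_inject by (intro the_equality) auto
qed

text \<open>The positive square root of \<open>A\<^sup>* A\<close> keeps the eigenbasis and replaces
  each eigenvalue by its modulus.\<close>

lemma trace_norm_spec_mat:
  assumes u: "orthonormal n n u"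
  shows "trace_norm (spec_mat n u f) = (\<Sum>l<n. \<bar>f l\<bar>)"
proof -
  have "mat_adjoint (spec_mat n u f) = spec_mat n u f"
    by (simp add: mat_adjoint_eq_iff[of _ n] hermitian_spec_mat)
  then have "psd_sqrt (mat_adjoint (spec_mat n u f) * spec_mat n u f) = spec_mat n u (\<lambda>l. \<bar>f l\<bar>)"
    by (intro psd_sqrt_eqI[of n] psd_spec_mat) (simp_all add: spec_mat_mult[OF u])
  then show ?thesis by (simp add: trace_norm_def trace_spec_mat[OF u])
qed

section \<open>The Hilbert-Schmidt norm\<close>

text \<open>Defined through the entries rather than a trace, so that invariance under a permutation
  of the entries is a rearrangement of the sum.\<close>

definition hs_norm :: "nat \<Rightarrow> (nat \<Rightarrow> nat \<Rightarrow> complex) \<Rightarrow> real" where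
  "hs_norm n A = sqrt (\<Sum>i<n. \<Sum>j<n. (cmod (A i j))\<^sup>2)"

text \<open>Both sides are the trace of the square of the Hermitian matrix, read once off the
  entries and once off the eigenvalues.\<close>

lemma hs_norm_spec_mat:
  assumes u: "orthonormal n n u"
  shows "(hs_norm n (ent (spec_mat n u f)))\<^sup>2 = (\<Sum>l<n. (f l)\<^sup>2)"
proof -
  let ?A = "spec_mat n u f"
  have *: "?A $$ (i, j) * ?A $$ (j, i) = of_real ((cmod (?A $$ (i, j)))\<^sup>2)" if "i < n" "j < n" for i j
  proof -
    have "?A $$ (j, i) = cnj (?A $$ (i, j))"
      using hermitian_spec_mat[of n u f] that by (simp add: hermitian_fun_def)
    then show ?thesis by (simp only: complex_norm_square)
  qed
  have "complex_of_real (\<Sum>l<n. (f l)\<^sup>2) = mat_trace (?A * ?A)"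
    unfolding spec_mat_mult[OF u] trace_spec_mat[OF u] by (simp add: power2_eq_square)
  also have "\<dots> = (\<Sum>i<n. \<Sum>j<n. ?A $$ (i, j) * ?A $$ (j, i))"
    by (simp add: mat_trace_def scalar_prod_def lessThan_atLeast0)
  also have "\<dots> = (\<Sum>i<n. \<Sum>j<n. of_real ((cmod (?A $$ (i, j)))\<^sup>2))"
    by (intro sum.cong refl) (simp only: * lessThan_iff)
  also have "\<dots> = of_real (\<Sum>i<n. \<Sum>j<n. (cmod (?A $$ (i, j)))\<^sup>2)" by simp
  finally have "(\<Sum>l<n. (f l)\<^sup>2) = (\<Sum>i<n. \<Sum>j<n. (cmod (?A $$ (i, j)))\<^sup>2)"
    by (simp only: of_real_eq_iff)
  then show ?thesis by (simp add: hs_norm_def sum_nonneg)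
qed

text \<open>A traceless family satisfies \<open>2 \<bar>f l\<bar> \<le> \<Sum>\<bar>f\<bar>\<close>, as \<open>f l\<close> is minus the sum of the others.\<close>

lemma traceless_sum_squares:
  fixes f :: "nat \<Rightarrow> real"
  assumes "(\<Sum>l<n. f l) = 0"
  shows "2 * (\<Sum>l<n. (f l)\<^sup>2) \<le> (\<Sum>l<n. \<bar>f l\<bar>)\<^sup>2"
proof -
  let ?S = "\<Sum>l<n. \<bar>f l\<bar>"
  have "2 * \<bar>f l\<bar> \<le> ?S" if "l < n" for l
  proof -
    have "f l = - (\<Sum>m\<in>{..<n} - {l}. f m)"
      using assms that by (simp add: sum.remove[of "{..<n}" l])
    then have "\<bar>f l\<bar> \<le> (\<Sum>m\<in>{..<n} - {l}. \<bar>f m\<bar>)" by (simp add: sum_abs)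
    moreover have "?S = \<bar>f l\<bar> + (\<Sum>m\<in>{..<n} - {l}. \<bar>f m\<bar>)"
      using that by (simp add: sum.remove)
    ultimately show ?thesis by simp
  qed
  then have "(\<Sum>l<n. 2 * \<bar>f l\<bar> * \<bar>f l\<bar>) \<le> (\<Sum>l<n. ?S * \<bar>f l\<bar>)"
    by (intro sum_mono mult_right_mono) auto
  then show ?thesis
    by (simp add: power2_eq_square sum_distrib_left mult.assoc)
qed

lemma trace_norm_nonneg:
  assumes A: "A \<in> carrier_mat n n" "hermitian_fun n (ent A)"
  shows "trace_norm A \<ge> 0"
proof -
  obtain u f where "orthonormal n n u" "A = spec_mat n u f"
    using spectral_theorem[OF A] by blast
  then show ?thesis by (simp add: trace_norm_spec_mat sum_nonneg)
qed

text \<open>Vanishing trace balances the positive and negative eigenvalues, which gains the factor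
  \<open>1 / sqrt 2\<close> over the general comparison of the two norms.\<close>

lemma traceless_hs_norm_le:
  assumes A: "A \<in> carrier_mat n n" "hermitian_fun n (ent A)" and tr: "mat_trace A = 0"
  shows "hs_norm n (ent A) \<le> trace_norm A / sqrt 2"
proof -
  obtain u f where u: "orthonormal n n u" and Af: "A = spec_mat n u f"
    using spectral_theorem[OF A] by blast
  have "(\<Sum>l<n. f l) = 0"
    using tr unfolding Af trace_spec_mat[OF u] by (simp only: of_real_eq_0_iff)
  then have "2 * (hs_norm n (ent A))\<^sup>2 \<le> (trace_norm A)\<^sup>2"
    unfolding Af hs_norm_spec_mat[OF u] trace_norm_spec_mat[OF u] by (rule traceless_sum_squares)
  then have "(hs_norm n (ent A))\<^sup>2 \<le> (trace_norm A / sqrt 2)\<^sup>2"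
    by (simp add: power_divide)
  then show ?thesis
    by (rule power2_le_imp_le) (simp add: trace_norm_nonneg[OF A])
qed

text \<open>Parseval's identity, applied to the conjugate of each row of \<open>A\<close>, lets the
  Hilbert-Schmidt norm be evaluated on any orthonormal basis.\<close>

lemma app_hs_norm:
  assumes u: "orthonormal n n u"
  shows "L2_set (\<lambda>l. L2_set (\<lambda>i. cmod (app n A (u l) i)) {..<n}) {..<n} = hs_norm n A"
proof -
  have "(\<Sum>l<n. (cmod (app n A (u l) i))\<^sup>2) = (\<Sum>j<n. (cmod (A i j))\<^sup>2)" for i
  proof -
    have "app n A (u l) i = cnj (cinner n (u l) (\<lambda>j. cnj (A i j)))" for l
      by (simp add: app_def cinner_def mult.commute)
    then show ?thesis using parseval[OF u, of "\<lambda>j. cnj (A i j)"] by simp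
  qed
  then have "(\<Sum>l<n. \<Sum>i<n. (cmod (app n A (u l) i))\<^sup>2) = (\<Sum>i<n. \<Sum>j<n. (cmod (A i j))\<^sup>2)"
    by (subst sum.swap) simp
  then show ?thesis by (simp add: L2_set_def hs_norm_def sum_nonneg)
qed

text \<open>Since \<open>\<langle>u, QYu\<rangle> = \<langle>Q\<^sup>* u, Yu\<rangle>\<close>, this is the Cauchy--Schwarz inequality together with
  Parseval's identity for \<open>Q\<^sup>*\<close> and \<open>Y\<close>.\<close>

lemma sum_expectation_le_hs_norm:
  assumes u: "orthonormal n n u"
    and QY: "\<And>i j. i < n \<Longrightarrow> j < n \<Longrightarrow> Y i j = (\<Sum>t<n. Q i t * Y t j)"
  shows "(\<Sum>l<n. cmod (cinner n (u l) (app n Y (u l)))) \<le> hs_norm n Q * hs_norm n Y"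
proof -
  define R where "R = (\<lambda>i j. cnj (Q j i))"
  have "cinner n (u l) (app n Y (u l)) = cinner n (app n R (u l)) (app n Y (u l))" for l
  proof -
    have "app n Y (u l) i = (\<Sum>t<n. Q i t * app n Y (u l) t)" if "i < n" for i
    proof -
      have "app n Y (u l) i = (\<Sum>j<n. \<Sum>t<n. Q i t * (Y t j * u l j))"
        unfolding app_def using QY[OF that] by (simp add: sum_distrib_right mult.assoc)
      also have "\<dots> = (\<Sum>t<n. Q i t * app n Y (u l) t)"
        unfolding app_def sum_distrib_left by (rule sum.swap)
      finally show ?thesis .
    qed
    then have "cinner n (u l) (app n Y (u l)) = cinner n (u l) (\<lambda>i. \<Sum>t<n. Q i t * app n Y (u l) t)"
      by (rule cinner_cong[OF refl])
    also have "\<dots> = cinner n (app n R (u l)) (app n Y (u l))"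
      unfolding cinner_def app_def[of n R] cnj_sum sum_distrib_left sum_distrib_right
      by (subst sum.swap) (simp add: R_def mult_ac)
    finally show ?thesis .
  qed
  then have "(\<Sum>l<n. cmod (cinner n (u l) (app n Y (u l)))) \<le>
      (\<Sum>l<n. L2_set (\<lambda>i. cmod (app n R (u l) i)) {..<n} * L2_set (\<lambda>i. cmod (app n Y (u l) i)) {..<n})"
    by (intro sum_mono) (simp add: cinner_cauchy_schwarz)
  \<comment> \<open>A second use of Cauchy-Schwarz, now over the index \<open>l\<close>, turns the
    factors into Hilbert-Schmidt norms.\<close>
  also have "\<dots> \<le> hs_norm n R * hs_norm n Y"
    unfolding app_hs_norm[OF u, symmetric]
    by (rule order_trans[OF _ L2_set_mult_ineq]) (simp add: L2_set_nonneg)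
  also have "hs_norm n R = hs_norm n Q"
    unfolding hs_norm_def R_def by (subst sum.swap) simp
  finally show ?thesis .
qed

subsection \<open>Pure states and partial transposition\<close>

lemma sum_product_index:
  fixes g :: "nat \<Rightarrow> 'a :: comm_monoid_add"
  shows "(\<Sum>r<d * k. g r) = (\<Sum>i<d. \<Sum>a<k. g (i * k + a))"
proof (induction d)
  case (Suc d)
  have "Suc d * k = d * k + k" by simp
  then show ?case by (simp only: sum_lessThan_add Suc.IH sum.lessThan_Suc)
qed simp

lemma product_index_less:
  fixes d k :: nat
  assumes "i < d" "a < k"
  shows "i * k + a < d * k"
proof -
  have "i * k + a < Suc i * k" using assms by simp
  also have "\<dots> \<le> d * k" using assms by (intro mult_right_mono) auto
  finally show ?thesis .
qed

lemma product_index_div_mod [simp]: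
  fixes k :: nat
  assumes "a < k"
  shows "(i * k + a) div k = i" "(i * k + a) mod k = a"
  using assms by auto

lemma product_index_split:
  fixes d k :: nat
  assumes "r < d * k"
  shows "r div k < d" "r mod k < k"
proof -
  show "r div k < d" using assms by (rule less_mult_imp_div_less)
  show "r mod k < k" using assms by (cases k) auto
qed

definition pure_state :: "nat \<Rightarrow> (nat \<Rightarrow> complex) \<Rightarrow> complex mat" where
  "pure_state n \<psi> = mat n n (\<lambda>(i, j). \<psi> i * cnj (\<psi> j))"

lemma density_pure_state:
  assumes "cinner n \<psi> \<psi> = 1"
  shows "density_operator n (pure_state n \<psi>)"
proof -
  have "psd n (pure_state n \<psi>)"
  proof (rule psdI)
    fix x
    have "app n (ent (pure_state n \<psi>)) x i = cinner n \<psi> x * \<psi> i" if "i < n" for i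
      using that by (simp add: app_def pure_state_def cinner_def sum_distrib_left mult_ac)
    then have "cinner n x (app n (ent (pure_state n \<psi>)) x) = cinner n x (\<lambda>i. cinner n \<psi> x * \<psi> i)"
      by (rule cinner_cong[OF refl])
    also have "\<dots> = cinner n \<psi> x * cnj (cinner n \<psi> x)"
      by (simp only: cinner_scale_right cnj_cinner)
    also have "\<dots> = of_real ((cmod (cinner n \<psi> x))\<^sup>2)"
      by (simp only: complex_norm_square)
    finally show "0 \<le> Re (cinner n x (app n (ent (pure_state n \<psi>)) x))" by simp
  qed (auto simp: pure_state_def hermitian_fun_def)
  moreover have "mat_trace (pure_state n \<psi>) = cinner n \<psi> \<psi>"
    by (simp add: mat_trace_def pure_state_def cinner_def mult.commute)
  ultimately show ?thesis using assms by (simp add: density_operator_def)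
qed

text \<open>The eigenvectors are the pure components; the eigenvalues are nonnegative as
  expectations and sum to the trace. The mixture is stated entrywise, the form in which
  \<open>tensor_id_sum\<close> consumes it.\<close>

lemma density_decomposition:
  assumes "density_operator n \<rho>"
  obtains \<psi> :: "nat \<Rightarrow> nat \<Rightarrow> complex" and p :: "nat \<Rightarrow> real" where
    "\<And>m. m < n \<Longrightarrow> cinner n (\<psi> m) (\<psi> m) = 1" "\<And>m. m < n \<Longrightarrow> p m \<ge> 0" "(\<Sum>m<n. p m) = 1"
    "\<And>i j. i < n \<Longrightarrow> j < n \<Longrightarrow> \<rho> $$ (i, j) = (\<Sum>m<n. p m * pure_state n (\<psi> m) $$ (i, j))"
proof -
  have psd: "psd n \<rho>" and tr: "mat_trace \<rho> = 1" using assms by (auto simp: density_operator_def)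
  obtain \<psi> p where \<psi>: "orthonormal n n \<psi>" and \<rho>: "\<rho> = spec_mat n \<psi> p"
    using spectral_theorem[OF psdD(1,2)[OF psd]] by blast
  have norm: "cinner n (\<psi> m) (\<psi> m) = 1" if "m < n" for m
    using \<psi> that by (simp add: orthonormal_def)
  have "p m \<ge> 0" if "m < n" for m
  proof -
    have "cinner n (\<psi> m) (app n (ent \<rho>) (\<psi> m)) = cinner n (\<psi> m) (\<lambda>i. \<Sum>l<n. p l * cinner n (\<psi> l) (\<psi> m) * \<psi> l i)"
      unfolding \<rho> by (intro cinner_cong refl app_spec_mat)
    also have "\<dots> = (\<Sum>l<n. complex_of_real (p l) * of_bool (l = m) * of_bool (m = l))"
      unfolding cinner_sum_right using \<psi> that by (intro sum.cong refl) (simp add: orthonormal_def)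
    also have "\<dots> = p m" using that by simp
    finally show ?thesis using psdD(3)[OF psd, of "\<psi> m"] by simp
  qed
  moreover have "(\<Sum>m<n. p m) = 1"
    using tr unfolding \<rho> trace_spec_mat[OF \<psi>] by (simp only: of_real_eq_1_iff)
  moreover have "\<rho> $$ (i, j) = (\<Sum>m<n. p m * pure_state n (\<psi> m) $$ (i, j))" if "i < n" "j < n" for i j
    unfolding \<rho> using that by (simp add: spec_mat_index pure_state_def mult.assoc)
  ultimately show ?thesis using norm by (rule that[rotated])
qed

section \<open>Linear maps acting on one tensor factor, and partial transposition\<close>

lemma linear_super_sum:
  assumes \<Phi>: "linear_super d \<Phi>" and "finite I" and B: "\<And>p. p \<in> I \<Longrightarrow> B p \<in> carrier_mat d d"
  shows "\<Phi> (mat d d (\<lambda>(i, j). \<Sum>p\<in>I. c p * B p $$ (i, j))) =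
    mat d d (\<lambda>(i, j). \<Sum>p\<in>I. c p * \<Phi> (B p) $$ (i, j))"
  using assms(2) B
proof (induction I rule: finite_induct)
  case empty
  \<comment> \<open>The zero matrix is written as \<open>0\<close> times itself, so homogeneity
    shows that \<open>\<Phi>\<close> maps it to zero.\<close>
  have "\<Phi> (0 \<cdot>\<^sub>m 0\<^sub>m d d) = 0 \<cdot>\<^sub>m \<Phi> (0\<^sub>m d d)" and 1: "\<Phi> (0\<^sub>m d d) \<in> carrier_mat d d"
    using \<Phi> zero_carrier_mat[of d d] unfolding linear_super_def by blast+
  moreover have "0 \<cdot>\<^sub>m 0\<^sub>m d d = mat d d (\<lambda>(i, j). 0 :: complex)"
    "0 \<cdot>\<^sub>m \<Phi> (0\<^sub>m d d) = mat d d (\<lambda>(i, j). 0)"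
    using 1 by (auto intro!: eq_matI)
  ultimately show ?case by (simp add: case_prod_unfold)
next
  case (insert x I)
  let ?R = "mat d d (\<lambda>(i, j). \<Sum>p\<in>I. c p * B p $$ (i, j))"
  have B: "B x \<in> carrier_mat d d" using insert.prems by simp
  then have \<Phi>B: "\<Phi> (B x) \<in> carrier_mat d d" using \<Phi> by (simp add: linear_super_def)
  have "mat d d (\<lambda>(i, j). \<Sum>p\<in>insert x I. c p * B p $$ (i, j)) = c x \<cdot>\<^sub>m B x + ?R"
    using B insert.hyps by (intro eq_matI) auto
  also have "\<Phi> \<dots> = c x \<cdot>\<^sub>m \<Phi> (B x) + \<Phi> ?R"
    using \<Phi> B by (simp add: linear_super_def)
  also have "\<dots> = mat d d (\<lambda>(i, j). \<Sum>p\<in>insert x I. c p * \<Phi> (B p) $$ (i, j))"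
    using \<Phi>B insert.hyps by (subst insert.IH) (use insert.prems in \<open>auto intro!: eq_matI\<close>)
  finally show ?case .
qed

lemma tensor_block_carrier [simp]: "tensor_block d k \<rho> a b \<in> carrier_mat d d"
  by (simp add: tensor_block_def)

lemma tensor_id_carrier [simp]: "tensor_id d k \<Phi> \<rho> \<in> carrier_mat (d * k) (d * k)"
  by (simp add: tensor_id_def)

lemma tensor_id_index:
  "r < d * k \<Longrightarrow> s < d * k \<Longrightarrow>
    tensor_id d k \<Phi> \<rho> $$ (r, s) = \<Phi> (tensor_block d k \<rho> (r mod k) (s mod k)) $$ (r div k, s div k)"
  by (simp add: tensor_id_def)

text \<open>Each block depends linearly on the whole operator, so linearity of \<open>\<Phi>\<close>
  passes to its extension by the identity.\<close>

lemma tensor_id_sum: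
  assumes \<Phi>: "linear_super d \<Phi>" and "finite I"
    and \<rho>: "\<And>i j. i < d * k \<Longrightarrow> j < d * k \<Longrightarrow> \<rho> $$ (i, j) = (\<Sum>m\<in>I. c m * \<sigma> m $$ (i, j))"
    and rs: "r < d * k" "s < d * k"
  shows "tensor_id d k \<Phi> \<rho> $$ (r, s) = (\<Sum>m\<in>I. c m * tensor_id d k \<Phi> (\<sigma> m) $$ (r, s))"
proof -
  let ?a = "r mod k" and ?b = "s mod k"
  have "tensor_block d k \<rho> ?a ?b =
      mat d d (\<lambda>(i, j). \<Sum>m\<in>I. c m * tensor_block d k (\<sigma> m) ?a ?b $$ (i, j))"
    using rs by (intro eq_matI) (auto simp: tensor_block_def \<rho> product_index_less product_index_split)
  then show ?thesis
    using linear_super_sum[OF \<Phi> \<open>finite I\<close>, of "\<lambda>m. tensor_block d k (\<sigma> m) ?a ?b" c] rs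
    by (simp add: tensor_id_index product_index_split)
qed

text \<open>Quotients by \<open>k\<close> are the indices of the first factor, remainders those of
  the second; transposing each block exchanges the former and keeps the latter.\<close>

lemma tensor_id_transpose_index:
  assumes \<Phi>: "linear_super d \<Phi>" and rs: "r < d * k" "s < d * k"
  shows "tensor_id d k (transpose_mat \<circ> \<Phi>) \<rho> $$ (r, s) =
    tensor_id d k \<Phi> \<rho> $$ (s div k * k + r mod k, r div k * k + s mod k)"
proof -
  have "\<Phi> (tensor_block d k \<rho> (r mod k) (s mod k)) \<in> carrier_mat d d"
    using \<Phi> by (simp add: linear_super_def)
  then show ?thesis
    using rs by (simp add: tensor_id_index product_index_split product_index_less)
qed

lemma linear_super_transpose:
  assumes \<Phi>: "linear_super d \<Phi>"
  shows "linear_super d (transpose_mat \<circ> \<Phi>)"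
  unfolding linear_super_def o_def
proof (intro conjI ballI allI)
  fix X Y :: "complex mat" and c
  assume X: "X \<in> carrier_mat d d" and Y: "Y \<in> carrier_mat d d"
  then show "transpose_mat (\<Phi> (X + Y)) = transpose_mat (\<Phi> X) + transpose_mat (\<Phi> Y)"
    using \<Phi> by (simp add: linear_super_def transpose_add[of _ d d])
next
  fix X :: "complex mat" and c
  assume X: "X \<in> carrier_mat d d"
  then have "\<Phi> X \<in> carrier_mat d d" "\<Phi> (c \<cdot>\<^sub>m X) = c \<cdot>\<^sub>m \<Phi> X"
    using \<Phi> by (simp_all add: linear_super_def)
  then show "transpose_mat (\<Phi> X) \<in> carrier_mat d d"
    "transpose_mat (\<Phi> (c \<cdot>\<^sub>m X)) = c \<cdot>\<^sub>m transpose_mat (\<Phi> X)"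
    by (auto intro!: eq_matI)
qed

lemma hermitian_partial_transpose:
  assumes \<Phi>: "linear_super d \<Phi>" and "hermitian_fun (d * k) (ent (tensor_id d k \<Phi> \<rho>))"
  shows "hermitian_fun (d * k) (ent (tensor_id d k (transpose_mat \<circ> \<Phi>) \<rho>))"
  using assms(2)
  by (simp add: hermitian_fun_def tensor_id_transpose_index[OF \<Phi>] product_index_less product_index_split)

lemma hs_norm_partial_transpose:
  assumes \<Phi>: "linear_super d \<Phi>"
  shows "hs_norm (d * k) (ent (tensor_id d k (transpose_mat \<circ> \<Phi>) \<rho>)) =
    hs_norm (d * k) (ent (tensor_id d k \<Phi> \<rho>))"
proof -
  \<comment> \<open>\<open>F\<close> absorbs the sum over \<open>b\<close>; the three interchanges
    that follow then exchange the roles of \<open>i\<close> and \<open>j\<close>.\<close>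
  define F where "F i a j = (\<Sum>b<k. (cmod (tensor_id d k \<Phi> \<rho> $$ (i * k + a, j * k + b)))\<^sup>2)" for i a j
  have "(\<Sum>i<d. \<Sum>a<k. \<Sum>j<d. F j a i) = (\<Sum>a<k. \<Sum>i<d. \<Sum>j<d. F j a i)" by (rule sum.swap)
  also have "\<dots> = (\<Sum>a<k. \<Sum>j<d. \<Sum>i<d. F j a i)" by (intro sum.cong refl sum.swap)
  also have "\<dots> = (\<Sum>j<d. \<Sum>a<k. \<Sum>i<d. F j a i)" by (rule sum.swap)
  finally show ?thesis
    by (simp add: hs_norm_def sum_product_index tensor_id_transpose_index[OF \<Phi>] product_index_less F_def)
qed

section \<open>A rank bound independent of the auxiliary dimension\<close>

text \<open>Gram-Schmidt is applied to the \<open>d\<close> vectors one by one; a vector already in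
  the span adds nothing, so at most \<open>d\<close> basis vectors arise whatever \<open>k\<close>
  is.\<close>

lemma exists_spanning_orthonormal:
  fixes w :: "nat \<Rightarrow> nat \<Rightarrow> complex"
  obtains r b where "r \<le> d" "orthonormal k r b"
    "\<And>i a. i < d \<Longrightarrow> a < k \<Longrightarrow> proj k r b (w i) a = w i a"
proof -
  have "\<exists>r\<le>d. \<exists>b. orthonormal k r b \<and> (\<forall>i<d. \<forall>a<k. proj k r b (w i) a = w i a)"
  proof (induction d)
    case 0
    then show ?case by (auto simp: orthonormal_def)
  next
    case (Suc d)
    then obtain r b where r: "r \<le> d" and b: "orthonormal k r b"
      and old: "\<forall>i<d. \<forall>a<k. proj k r b (w i) a = w i a" by blast
    show ?case
    proof (cases "\<forall>a<k. proj k r b (w d) a = w d a")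
      case True
      then show ?thesis using r b old by (intro exI[of _ r]) (auto simp: less_Suc_eq)
    next
      case False
      then obtain a where "a < k" "w d a \<noteq> proj k r b (w d) a" by auto
      then obtain z where z: "orthonormal k (Suc r) (b(r := z))"
        and new: "\<And>j. proj k (Suc r) (b(r := z)) (w d) j = w d j"
        using orthonormal_extend[OF b] by blast
      have "proj k (Suc r) (b(r := z)) (w i) a = w i a" if "i < d" "a < k" for i a
      proof -
        have zb: "cinner k z (b q) = 0" if "q < r" for q
        proof -
          have "cinner k ((b(r := z)) r) ((b(r := z)) q) = of_bool (r = q)"
            using z that by (simp add: orthonormal_def del: fun_upd_apply)
          then show ?thesis using that by simp
        qed
        \<comment> \<open>An earlier vector lies in the old span, to which \<open>z\<close> is
          orthogonal, so its coefficient along \<open>z\<close> vanishes and its projection is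
          unchanged.\<close>
        have "cinner k z (w i) = cinner k z (proj k r b (w i))"
          using old \<open>i < d\<close> by (intro cinner_cong) auto
        also have "\<dots> = (\<Sum>q<r. cinner k (b q) (w i) * cinner k z (b q))"
          unfolding proj_def by (rule cinner_sum_right)
        also have "\<dots> = 0" using zb by simp
        finally show ?thesis using old that by (simp add: proj_def)
      qed
      then show ?thesis using z new r
        by (intro exI[of _ "Suc r"]) (auto simp: less_Suc_eq simp del: fun_upd_apply)
    qed
  qed
  then show ?thesis using that by blast
qed

text \<open>By orthonormality, row \<open>a\<close> of the projection onto the span of the
  \<open>b q\<close> has as squared norm the sum of the \<open>|b q a|^2\<close>; summing over
  \<open>a\<close> counts the \<open>r\<close> unit vectors, so the total is the rank.\<close>

lemma hs_norm_projection:
  assumes b: "orthonormal k r b"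
  shows "(\<Sum>a<k. \<Sum>c<k. (cmod (\<Sum>q<r. b q a * cnj (b q c)))\<^sup>2) = r"
proof -
  have "(\<Sum>c<k. (cmod (\<Sum>q<r. b q a * cnj (b q c)))\<^sup>2) = (\<Sum>q<r. (cmod (b q a))\<^sup>2)" for a
  proof -
    let ?v = "\<lambda>c. \<Sum>q<r. cnj (b q a) * b q c"
    have "(\<Sum>c<k. (cmod (\<Sum>q<r. b q a * cnj (b q c)))\<^sup>2) = (\<Sum>c<k. (cmod (?v c))\<^sup>2)"
    proof (intro sum.cong refl)
      fix c
      have "(\<Sum>q<r. b q a * cnj (b q c)) = cnj (?v c)" by simp
      then show "(cmod (\<Sum>q<r. b q a * cnj (b q c)))\<^sup>2 = (cmod (?v c))\<^sup>2"
        by (simp only: complex_mod_cnj)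
    qed
    moreover have "of_real (\<Sum>c<k. (cmod (?v c))\<^sup>2) = cinner k ?v ?v" by (rule cinner_self[symmetric])
    moreover have "cinner k ?v ?v = (\<Sum>p<r. b p a * (\<Sum>q<r. cnj (b q a) * of_bool (p = q)))"
      unfolding cinner_sum_left cinner_sum_right using b
      by (intro sum.cong refl) (simp add: orthonormal_def)
    moreover have "\<dots> = of_real (\<Sum>q<r. (cmod (b q a))\<^sup>2)"
      by (simp add: complex_norm_square del: of_real_power)
    ultimately show ?thesis by (simp only: of_real_eq_iff)
  qed
  then have "(\<Sum>a<k. \<Sum>c<k. (cmod (\<Sum>q<r. b q a * cnj (b q c)))\<^sup>2) = (\<Sum>q<r. \<Sum>a<k. (cmod (b q a))\<^sup>2)"
    by (simp add: sum.swap[of _ "{..<r}"])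
  also have "(\<Sum>a<k. (cmod (b q a))\<^sup>2) = 1" if "q < r" for q
  proof -
    have "complex_of_real (\<Sum>a<k. (cmod (b q a))\<^sup>2) = 1"
      unfolding cinner_self[symmetric] using b that by (simp add: orthonormal_def)
    then show ?thesis by (simp only: of_real_eq_1_iff)
  qed
  then have "(\<Sum>q<r. \<Sum>a<k. (cmod (b q a))\<^sup>2) = r" by simp
  finally show ?thesis .
qed

text \<open>Writing \<open>\<psi> = \<Sum>\<^sub>i e\<^sub>i \<otimes> w\<^sub>i\<close> and \<open>P\<close> for the projection onto the span of the \<open>d\<close> vectors \<open>w\<^sub>i\<close>,
  the operator \<open>Y = (\<Phi> \<otimes> id)(\<psi>\<psi>\<^sup>*)\<close> satisfies \<open>Y = (1 \<otimes> P) Y\<close>, and \<open>1 \<otimes> P\<close> has rank at most \<open>d\<^sup>2\<close>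
  however large \<open>k\<close> is.\<close>

lemma sum_expectation_tensor_pure_state:
  fixes \<psi> :: "nat \<Rightarrow> complex"
  assumes \<Phi>: "linear_super d \<Phi>" and u: "orthonormal (d * k) (d * k) u"
  defines "Y \<equiv> tensor_id d k \<Phi> (pure_state (d * k) \<psi>)"
  shows "(\<Sum>l<d * k. cmod (cinner (d * k) (u l) (app (d * k) (ent Y) (u l)))) \<le> d * hs_norm (d * k) (ent Y)"
proof -
  obtain m b where m: "m \<le> d" and b: "orthonormal k m b"
    and w: "\<And>i a. i < d \<Longrightarrow> a < k \<Longrightarrow> proj k m b (\<lambda>a. \<psi> (i * k + a)) a = \<psi> (i * k + a)"
    using exists_spanning_orthonormal[of d k "\<lambda>i a. \<psi> (i * k + a)"] by blast
  define P where "P a c = (\<Sum>q<m. b q a * cnj (b q c))" for a c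
  \<comment> \<open>The matrix of \<open>1 \<otimes> P\<close>: diagonal in the first index,
    \<open>P\<close> in the second.\<close>
  define Q where "Q r t = of_bool (r div k = t div k) * P (r mod k) (t mod k)" for r t
  have P: "\<psi> (i * k + a) = (\<Sum>c<k. P a c * \<psi> (i * k + c))" if "i < d" "a < k" for i a
  proof -
    have "\<psi> (i * k + a) = (\<Sum>q<m. \<Sum>c<k. b q a * cnj (b q c) * \<psi> (i * k + c))"
      using w[OF that] by (simp add: proj_def cinner_def sum_distrib_left sum_distrib_right mult_ac)
    also have "\<dots> = (\<Sum>c<k. P a c * \<psi> (i * k + c))"
      unfolding P_def sum_distrib_right by (rule sum.swap)
    finally show ?thesis .
  qed
  have "Y $$ (r, s) = (\<Sum>t<d * k. Q r t * Y $$ (t, s))" if rs: "r < d * k" "s < d * k" for r s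
  proof -
    let ?B = "\<lambda>c. tensor_block d k (pure_state (d * k) \<psi>) c (s mod k)"
    \<comment> \<open>Since \<open>P\<close> fixes every \<open>w\<^sub>i\<close>, each block is a
      combination of the blocks in its block column with coefficients from \<open>P\<close>;
      \<open>\<Phi>\<close> acts inside the blocks and respects this combination.\<close>
    have "?B (r mod k) = mat d d (\<lambda>(i, j). \<Sum>c<k. P (r mod k) c * ?B c $$ (i, j))"
    proof (rule eq_matI)
      fix i j assume "i < dim_row (mat d d (\<lambda>(i, j). \<Sum>c<k. P (r mod k) c * ?B c $$ (i, j)))"
        "j < dim_col (mat d d (\<lambda>(i, j). \<Sum>c<k. P (r mod k) c * ?B c $$ (i, j)))"
      then have ij: "i < d" "j < d" by simp_all
      then show "?B (r mod k) $$ (i, j) = mat d d (\<lambda>(i, j). \<Sum>c<k. P (r mod k) c * ?B c $$ (i, j)) $$ (i, j)"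
        using rs P[OF ij(1), of "r mod k"]
        by (simp add: tensor_block_def pure_state_def product_index_less product_index_split
            sum_distrib_right mult.assoc)
    qed (simp_all add: tensor_block_def)
    then have "Y $$ (r, s) = (\<Sum>c<k. P (r mod k) c * \<Phi> (?B c) $$ (r div k, s div k))"
      using linear_super_sum[OF \<Phi>, of "{..<k}" ?B "P (r mod k)"] rs
      by (simp add: Y_def tensor_id_index product_index_split)
    also have "\<dots> = (\<Sum>i<d. of_bool (r div k = i) * (\<Sum>c<k. P (r mod k) c * \<Phi> (?B c) $$ (i, s div k)))"
      using rs by (simp add: product_index_split)
    also have "\<dots> = (\<Sum>t<d * k. Q r t * Y $$ (t, s))"
      using rs unfolding sum_product_index
      by (simp add: Y_def Q_def tensor_id_index product_index_less sum_distrib_left mult.assoc)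
    finally show ?thesis .
  qed
  then have "(\<Sum>l<d * k. cmod (cinner (d * k) (u l) (app (d * k) (ent Y) (u l)))) \<le>
      hs_norm (d * k) Q * hs_norm (d * k) (ent Y)"
    by (intro sum_expectation_le_hs_norm[OF u])
  also have "hs_norm (d * k) Q \<le> d"
  proof -
    \<comment> \<open>The squared norm of \<open>1 \<otimes> P\<close> is \<open>d\<close> times the
      rank \<open>m \<le> d\<close> of \<open>P\<close>; this is where the factor \<open>d\<close>
      arises.\<close>
    have "(\<Sum>r<d * k. \<Sum>t<d * k. (cmod (Q r t))\<^sup>2) =
        (\<Sum>i<d. \<Sum>a<k. \<Sum>j<d. \<Sum>c<k. of_bool (i = j) * (cmod (P a c))\<^sup>2)"
      unfolding sum_product_index by (intro sum.cong refl) (simp add: Q_def norm_mult of_bool_def)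
    also have "\<dots> = (\<Sum>i<d. \<Sum>a<k. \<Sum>c<k. (cmod (P a c))\<^sup>2)"
      unfolding sum_distrib_left[symmetric] by (rule sum.cong[OF refl], rule sum.cong[OF refl]) simp
    also have "\<dots> = real d * real m"
      unfolding P_def hs_norm_projection[OF b] by simp
    also have "\<dots> \<le> (real d)\<^sup>2" using m by (simp add: power2_eq_square mult_left_mono)
    finally show ?thesis unfolding hs_norm_def by (rule real_le_lsqrt[rotated]) simp
  qed
  then have "hs_norm (d * k) Q * hs_norm (d * k) (ent Y) \<le> d * hs_norm (d * k) (ent Y)"
    by (rule mult_right_mono) (simp add: hs_norm_def sum_nonneg)
  finally show ?thesis .
qed

subsection \<open>The diamond norm\<close>

lemma trace_norm_le_diamond_norm:
  assumes "k \<ge> 1" "density_operator (d * k) \<rho>"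
  shows "ereal (trace_norm (tensor_id d k \<Phi> \<rho>)) \<le> diamond_norm d \<Phi>"
  unfolding diamond_norm_def
  using assms by (intro SUP_upper2[of k] SUP_upper2[of \<rho>]) auto

text \<open>The maximally entangled state \<open>\<omega>\<close> at \<open>k = d\<close> is sent to
  the flip divided by \<open>d\<close>. The flip is unitary, so the positive square root of
  \<open>Y\<^sup>* Y\<close> is \<open>S\<close>, the identity divided by \<open>d\<close>, and its
  trace is \<open>d^2 / d\<close>.\<close>

lemma diamond_norm_transpose_ge:
  assumes "d \<ge> 1"
  shows "ereal (real d) \<le> diamond_norm d transpose_mat"
proof -
  define \<omega> where "\<omega> r = (of_bool (r div d = r mod d) / complex_of_real (sqrt d))" for r
  define Y where "Y = tensor_id d d transpose_mat (pure_state (d * d) \<omega>)"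
  define S where "S = mat (d * d) (d * d) (\<lambda>(r, s). of_bool (r = s) / complex_of_nat d)"
  have sqrt: "complex_of_real (sqrt d) * complex_of_real (sqrt d) = of_nat d"
    by (simp flip: of_real_mult)
  have "cinner (d * d) \<omega> \<omega> = (\<Sum>i<d. \<Sum>a<d. of_bool (i = a) * (1 / of_nat d))"
    unfolding cinner_def sum_product_index
    by (intro sum.cong refl) (simp add: \<omega>_def sqrt)
  also have "\<dots> = (\<Sum>i<d. 1 / of_nat d)" by (intro sum.cong refl) (simp only: sum_of_bool_mult lessThan_iff)
  also have "\<dots> = 1" using assms by simp
  finally have density: "density_operator (d * d) (pure_state (d * d) \<omega>)"
    by (rule density_pure_state)
  have Y: "Y $$ (r, s) = of_bool (r div d = s mod d) * of_bool (s div d = r mod d) / of_nat d"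
    if "r < d * d" "s < d * d" for r s
    using that
    by (simp add: Y_def tensor_id_index tensor_block_def pure_state_def product_index_split
        product_index_less \<omega>_def sqrt)
  have Yc: "Y \<in> carrier_mat (d * d) (d * d)" by (simp add: Y_def)
  have "S * S = mat_adjoint Y * Y"
  proof (rule eq_matI)
    fix r s assume "r < dim_row (mat_adjoint Y * Y)" "s < dim_col (mat_adjoint Y * Y)"
    then have rs: "r < d * d" "s < d * d" using Yc mat_adjoint_carrier[OF Yc] by auto
    have "(mat_adjoint Y * Y) $$ (r, s) = (\<Sum>t<d * d. cnj (Y $$ (t, r)) * Y $$ (t, s))"
      using rs Yc mat_adjoint_carrier[OF Yc]
      by (simp add: scalar_prod_def lessThan_atLeast0 mat_adjoint_index[OF Yc])
    \<comment> \<open>The only index \<open>t\<close> that can contribute is \<open>r\<close> with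
      its quotient and remainder exchanged.\<close>
    also have "\<dots> = (\<Sum>i<d. of_bool (i = r mod d) * (\<Sum>a<d. of_bool (a = r div d) *
        (of_bool (i = s mod d) * of_bool (a = s div d) / (of_nat d * of_nat d))))"
      unfolding sum_product_index sum_distrib_left using rs
      by (intro sum.cong refl) (auto simp: Y product_index_less)
    also have "\<dots> = of_bool (r mod d = s mod d) * of_bool (r div d = s div d) / (of_nat d * of_nat d)"
      by (simp only: sum_of_bool_mult product_index_split[OF rs(1)])
    also have "\<dots> = of_bool (r = s) / (of_nat d * of_nat d)"
      by (auto simp: of_bool_def) (metis div_mult_mod_eq)
    also have "\<dots> = (\<Sum>t<d * d. of_bool (r = t) * (of_bool (t = s) / (of_nat d * of_nat d)))"
      by (simp only: sum_of_bool_mult rs)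
    also have "\<dots> = (\<Sum>t<d * d. S $$ (r, t) * S $$ (t, s))"
      using rs by (intro sum.cong refl) (simp add: S_def)
    also have "\<dots> = (S * S) $$ (r, s)"
      using rs by (simp add: S_def scalar_prod_def lessThan_atLeast0)
    finally show "(S * S) $$ (r, s) = (mat_adjoint Y * Y) $$ (r, s)" by simp
  qed (use Yc mat_adjoint_carrier[OF Yc] in \<open>auto simp: S_def\<close>)
  moreover have "psd (d * d) S"
  proof (rule psdI)
    fix x
    have "app (d * d) (ent S) x i = (1 / of_nat d) * x i" if "i < d * d" for i
    proof -
      have "app (d * d) (ent S) x i = (\<Sum>j<d * d. of_bool (i = j) * (x j / of_nat d))"
        unfolding app_def S_def using that by (intro sum.cong refl) simp
      also have "\<dots> = x i / of_nat d" using that by (simp only: sum_of_bool_mult)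
      finally show ?thesis by simp
    qed
    then have "cinner (d * d) x (app (d * d) (ent S) x) = cinner (d * d) x (\<lambda>i. (1 / of_nat d) * x i)"
      by (rule cinner_cong[OF refl])
    also have "\<dots> = of_real (1 / d * (\<Sum>i<d * d. (cmod (x i))\<^sup>2))"
      unfolding cinner_scale_right cinner_self by simp
    finally show "0 \<le> Re (cinner (d * d) x (app (d * d) (ent S) x))"
      by (simp add: sum_nonneg del: of_real_mult of_real_sum)
  qed (auto simp: S_def hermitian_fun_def)
  ultimately have "trace_norm Y = Re (mat_trace S)"
    unfolding trace_norm_def by (subst psd_sqrt_eqI) auto
  also have "mat_trace S = of_nat d"
    using assms by (simp add: mat_trace_def S_def)
  finally have "trace_norm Y = d" by simp
  then show ?thesis
    using trace_norm_le_diamond_norm[OF assms density, of transpose_mat] by (simp add: Y_def)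
qed

section \<open>The identity minus a channel\<close>

lemma linear_super_id_minus:
  assumes "linear_super d T"
  shows "linear_super d (\<lambda>X. X - T X)"
  unfolding linear_super_def
proof (intro conjI ballI allI)
  fix X Y :: "complex mat"
  assume X: "X \<in> carrier_mat d d" and Y: "Y \<in> carrier_mat d d"
  then have "T X \<in> carrier_mat d d" "T Y \<in> carrier_mat d d" "T (X + Y) = T X + T Y"
    using assms by (simp_all add: linear_super_def)
  with X Y show "X + Y - T (X + Y) = X - T X + (Y - T Y)"
    by (auto intro!: eq_matI)
next
  fix X :: "complex mat" and c
  assume X: "X \<in> carrier_mat d d"
  then have "T X \<in> carrier_mat d d" "T (c \<cdot>\<^sub>m X) = c \<cdot>\<^sub>m T X"
    using assms by (simp_all add: linear_super_def)
  with X show "X - T X \<in> carrier_mat d d" "c \<cdot>\<^sub>m X - T (c \<cdot>\<^sub>m X) = c \<cdot>\<^sub>m (X - T X)"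
    by (auto intro!: eq_matI simp: right_diff_distrib)
qed

lemma tensor_id_minus:
  assumes T: "linear_super d T" and rs: "r < d * k" "s < d * k"
  shows "tensor_id d k (\<lambda>X. X - T X) \<rho> $$ (r, s) = \<rho> $$ (r, s) - tensor_id d k T \<rho> $$ (r, s)"
proof -
  have "T (tensor_block d k \<rho> (r mod k) (s mod k)) \<in> carrier_mat d d"
    using T by (simp add: linear_super_def)
  then show ?thesis
    using rs by (simp add: tensor_id_index tensor_block_def product_index_split)
qed

text \<open>Splitting the diagonal by its second index reduces tracelessness after tensoring to
  tracelessness of the map on single blocks.\<close>

lemma mat_trace_tensor_id:
  assumes \<Phi>: "linear_super d \<Phi>"
  shows "mat_trace (tensor_id d k \<Phi> \<rho>) = (\<Sum>a<k. mat_trace (\<Phi> (tensor_block d k \<rho> a a)))"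
proof -
  have "dim_row (\<Phi> (tensor_block d k \<rho> a a)) = d" for a
    using \<Phi> tensor_block_carrier unfolding linear_super_def by blast
  then have "(\<Sum>a<k. mat_trace (\<Phi> (tensor_block d k \<rho> a a))) =
      (\<Sum>i<d. \<Sum>a<k. \<Phi> (tensor_block d k \<rho> a a) $$ (i, i))"
    unfolding mat_trace_def by (subst sum.swap) simp
  moreover have "dim_row (tensor_id d k \<Phi> \<rho>) = d * k" by (simp add: tensor_id_def)
  ultimately show ?thesis
    by (simp add: mat_trace_def sum_product_index tensor_id_index product_index_less)
qed

text \<open>The output is a difference of two positive operators, the second by complete positivity
  at dimension \<open>k\<close>, hence Hermitian. Its trace vanishes because \<open>T\<close>
  preserves the trace of each diagonal block.\<close>

lemma channel_difference_output:
  assumes T: "quantum_channel d T" and k: "k \<ge> 1" and \<rho>: "density_operator (d * k) \<rho>"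
  defines "X \<equiv> tensor_id d k (\<lambda>X. X - T X) \<rho>"
  shows "hermitian_fun (d * k) (ent X)" "mat_trace X = 0"
proof -
  have lin: "linear_super d T" using T by (simp add: quantum_channel_def)
  have "psd (d * k) \<rho>" using \<rho> by (simp add: density_operator_def)
  moreover from this have "psd (d * k) (tensor_id d k T \<rho>)"
    using T k by (simp add: quantum_channel_def completely_positive_def)
  ultimately have "hermitian_fun (d * k) (ent \<rho>)" "hermitian_fun (d * k) (ent (tensor_id d k T \<rho>))"
    by (auto dest: psdD(2))
  then show "hermitian_fun (d * k) (ent X)"
    by (simp add: hermitian_fun_def X_def tensor_id_minus[OF lin])
  have "mat_trace (B - T B) = 0" if B: "B \<in> carrier_mat d d" for B
  proof -
    have "T B \<in> carrier_mat d d" "mat_trace (T B) = mat_trace B"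
      using lin T B by (simp_all add: linear_super_def quantum_channel_def trace_preserving_def)
    with B show ?thesis by (simp add: mat_trace_def sum_subtractf)
  qed
  then show "mat_trace X = 0"
    unfolding X_def by (simp add: mat_trace_tensor_id[OF linear_super_id_minus[OF lin]])
qed

text \<open>Fixing one eigenbasis \<open>u\<close> of the output of \<open>\<rho>\<close> makes its
  trace norm a sum of moduli of expectations. With \<open>u\<close> fixed such a sum is convex in
  the input, so the estimate for pure states passes to mixtures. A real bound \<open>D\<close> keeps
  the arithmetic out of the extended reals.\<close>

lemma trace_norm_transposed_channel_difference:
  fixes D :: real
  assumes T: "quantum_channel d T" and k: "k \<ge> 1" and \<rho>: "density_operator (d * k) \<rho>"
    and D: "diamond_norm d (\<lambda>X. X - T X) \<le> ereal D"
  shows "trace_norm (tensor_id d k (transpose_mat \<circ> (\<lambda>X. X - T X)) \<rho>) \<le> d / sqrt 2 * D"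
proof -
  let ?n = "d * k" and ?\<Phi> = "\<lambda>X. X - T X"
  let ?Y = "tensor_id d k (transpose_mat \<circ> ?\<Phi>)" and ?X = "tensor_id d k ?\<Phi>"
  have \<Phi>: "linear_super d ?\<Phi>"
    using T by (simp add: quantum_channel_def linear_super_id_minus)
  have Y: "hermitian_fun ?n (ent (?Y \<rho>))"
    by (rule hermitian_partial_transpose[OF \<Phi> channel_difference_output(1)[OF T k \<rho>]])
  obtain u f where u: "orthonormal ?n ?n u" and Yf: "?Y \<rho> = spec_mat ?n u f"
    using spectral_theorem[OF tensor_id_carrier Y] by blast
  obtain \<psi> :: "nat \<Rightarrow> nat \<Rightarrow> complex" and p :: "nat \<Rightarrow> real" where
    \<psi>: "\<And>m. m < ?n \<Longrightarrow> cinner ?n (\<psi> m) (\<psi> m) = 1" and p: "\<And>m. m < ?n \<Longrightarrow> p m \<ge> 0" "(\<Sum>m<?n. p m) = 1"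
    and \<rho>p: "\<And>i j. i < ?n \<Longrightarrow> j < ?n \<Longrightarrow> \<rho> $$ (i, j) = (\<Sum>m<?n. p m * pure_state ?n (\<psi> m) $$ (i, j))"
    by (rule density_decomposition[OF \<rho>]) blast
  let ?Z = "\<lambda>m. ?Y (pure_state ?n (\<psi> m))"
  let ?e = "\<lambda>m l. cinner ?n (u l) (app ?n (ent (?Z m)) (u l))"
  \<comment> \<open>Each eigenvalue is the expectation of the output in \<open>u l\<close>, hence
    the average with weights \<open>p m\<close> of the expectations of the pure outputs.\<close>
  have f: "of_real (f l) = (\<Sum>m<?n. p m * ?e m l)" if l: "l < ?n" for l
  proof -
    have "cinner ?n (u l) (app ?n (ent (?Y \<rho>)) (u l)) = cinner ?n (u l) (\<lambda>i. \<Sum>q<?n. f q * cinner ?n (u q) (u l) * u q i)"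
      unfolding Yf by (intro cinner_cong refl app_spec_mat)
    also have "\<dots> = (\<Sum>q<?n. complex_of_real (f q) * of_bool (q = l) * of_bool (l = q))"
      unfolding cinner_sum_right using u l by (intro sum.cong refl) (simp add: orthonormal_def)
    also have "\<dots> = f l" using l by simp
    finally have "of_real (f l) = cinner ?n (u l) (app ?n (ent (?Y \<rho>)) (u l))" by simp
    also have "\<dots> = cinner ?n (u l) (\<lambda>i. \<Sum>m<?n. p m * app ?n (ent (?Z m)) (u l) i)"
    proof (rule cinner_cong[OF refl])
      fix i assume i: "i < ?n"
      have "app ?n (ent (?Y \<rho>)) (u l) i = (\<Sum>j<?n. \<Sum>m<?n. p m * (?Z m $$ (i, j) * u l j))"
        unfolding app_def
        by (intro sum.cong refl)
          (simp add: tensor_id_sum[OF linear_super_transpose[OF \<Phi>] _ \<rho>p i] sum_distrib_right mult.assoc)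
      also have "\<dots> = (\<Sum>m<?n. p m * app ?n (ent (?Z m)) (u l) i)"
        unfolding app_def sum_distrib_left by (rule sum.swap)
      finally show "app ?n (ent (?Y \<rho>)) (u l) i = (\<Sum>m<?n. p m * app ?n (ent (?Z m)) (u l) i)" .
    qed
    also have "\<dots> = (\<Sum>m<?n. p m * ?e m l)" by (rule cinner_sum_right)
    finally show ?thesis .
  qed
  \<comment> \<open>For a pure component the rank bound costs \<open>d\<close>, partial
    transposition preserves the Hilbert-Schmidt norm, and tracelessness gains
    \<open>1 / sqrt 2\<close>.\<close>
  have Z: "(\<Sum>l<?n. cmod (?e m l)) \<le> d / sqrt 2 * D" if m: "m < ?n" for m
  proof -
    let ?\<sigma> = "pure_state ?n (\<psi> m)"
    have \<sigma>: "density_operator ?n ?\<sigma>" by (rule density_pure_state[OF \<psi>[OF m]])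
    have "(\<Sum>l<?n. cmod (?e m l)) \<le> d * hs_norm ?n (ent (?Z m))"
      by (rule sum_expectation_tensor_pure_state[OF linear_super_transpose[OF \<Phi>] u])
    also have "hs_norm ?n (ent (?Z m)) = hs_norm ?n (ent (?X ?\<sigma>))"
      by (rule hs_norm_partial_transpose[OF \<Phi>])
    also have "d * \<dots> \<le> d * (trace_norm (?X ?\<sigma>) / sqrt 2)"
      using channel_difference_output[OF T k \<sigma>] by (intro mult_left_mono traceless_hs_norm_le) auto
    also have "\<dots> \<le> d * (D / sqrt 2)"
      using order_trans[OF trace_norm_le_diamond_norm[OF k \<sigma>] D]
      by (intro mult_left_mono divide_right_mono) auto
    also have "\<dots> = d / sqrt 2 * D" by simp
    finally show ?thesis .
  qed
  have "trace_norm (?Y \<rho>) = (\<Sum>l<?n. \<bar>f l\<bar>)" unfolding Yf by (rule trace_norm_spec_mat[OF u])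
  also have "\<dots> \<le> (\<Sum>l<?n. \<Sum>m<?n. p m * cmod (?e m l))"
  proof (rule sum_mono)
    fix l assume "l \<in> {..<?n}"
    then have "complex_of_real (f l) = (\<Sum>m<?n. p m * ?e m l)" by (intro f) simp
    then have "\<bar>f l\<bar> = cmod (\<Sum>m<?n. p m * ?e m l)" by (metis norm_of_real)
    also have "\<dots> \<le> (\<Sum>m<?n. cmod (p m * ?e m l))" by (rule norm_sum)
    also have "\<dots> = (\<Sum>m<?n. p m * cmod (?e m l))"
      using p(1) by (intro sum.cong refl) (simp add: norm_mult)
    finally show "\<bar>f l\<bar> \<le> (\<Sum>m<?n. p m * cmod (?e m l))" .
  qed
  also have "\<dots> = (\<Sum>m<?n. p m * (\<Sum>l<?n. cmod (?e m l)))"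
    unfolding sum_distrib_left by (rule sum.swap)
  also have "\<dots> \<le> (\<Sum>m<?n. p m * (d / sqrt 2 * D))"
    using Z p(1) by (intro sum_mono mult_left_mono) auto
  also have "\<dots> = d / sqrt 2 * D"
    unfolding sum_distrib_right[symmetric] p(2) by simp
  finally show ?thesis .
qed

text \<open>One output bounds the supremum from below: \<open>k = 1\<close> and the first basis
  state, which exists as \<open>d \<ge> 1\<close>. Nonnegativity excludes
  \<open>-\<infinity>\<close> and licenses monotone multiplication in the extended reals.\<close>

lemma diamond_norm_id_minus_channel_nonneg:
  assumes d: "d \<ge> 1" and T: "quantum_channel d T"
  shows "diamond_norm d (\<lambda>X. X - T X) \<ge> 0"
proof -
  have "cinner (d * 1) (\<lambda>i. of_bool (i = 0)) (\<lambda>i. of_bool (i = 0)) = 1"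
    using d by (simp add: cinner_def)
  then have \<rho>: "density_operator (d * 1) (pure_state (d * 1) (\<lambda>i. of_bool (i = 0)))"
    by (rule density_pure_state)
  have "0 \<le> trace_norm (tensor_id d 1 (\<lambda>X. X - T X) (pure_state (d * 1) (\<lambda>i. of_bool (i = 0))))"
    by (rule trace_norm_nonneg[OF tensor_id_carrier channel_difference_output(1)[OF T order_refl \<rho>]])
  then show ?thesis
    using trace_norm_le_diamond_norm[OF order_refl \<rho>, of "\<lambda>X. X - T X"]
    by (metis ereal_less_eq(5) order_trans)
qed

theorem theorem1:
  fixes d :: nat and T :: "complex mat \<Rightarrow> complex mat"
  assumes "d \<ge> 1" and "quantum_channel d T"
  shows "diamond_norm d (transpose_mat \<circ> (\<lambda>X. X - T X))
           \<le> ereal (1 / sqrt 2) * diamond_norm d transpose_mat * diamond_norm d (\<lambda>X. X - T X)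
       \<and> diamond_norm d (transpose_mat \<circ> (\<lambda>X. X - T X))
           \<le> ereal (real d / sqrt 2) * diamond_norm d (\<lambda>X. X - T X)"
proof -
  let ?D = "diamond_norm d (\<lambda>X. X - T X)"
  have D0: "?D \<ge> 0" by (rule diamond_norm_id_minus_channel_nonneg[OF assms])
  have bound: "diamond_norm d (transpose_mat \<circ> (\<lambda>X. X - T X)) \<le> ereal (real d / sqrt 2) * ?D"
  \<comment> \<open>If the norm is infinite, so is the right side, because
    \<open>d / sqrt 2 > 0\<close>; the value \<open>-\<infinity>\<close> contradicts
    \<open>D0\<close>.\<close>
  proof (cases ?D)
    case (real D)
    have "ereal (trace_norm (tensor_id d k (transpose_mat \<circ> (\<lambda>X. X - T X)) \<rho>)) \<le> ereal (d / sqrt 2 * D)"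
      if "k \<ge> 1" "density_operator (d * k) \<rho>" for k \<rho>
      using trace_norm_transposed_channel_difference[OF assms(2) that] real by simp
    then show ?thesis unfolding diamond_norm_def[of d "transpose_mat \<circ> _"] real
      by (intro SUP_least) auto
  qed (use assms D0 in auto)
  \<comment> \<open>The first inequality follows from the second: the factor \<open>d\<close> is at
    most the norm of the transposition.\<close>
  have "ereal (real d / sqrt 2) = ereal (1 / sqrt 2) * ereal (real d)" by simp
  also have "\<dots> \<le> ereal (1 / sqrt 2) * diamond_norm d transpose_mat"
    using diamond_norm_transpose_ge[OF assms(1)] by (intro ereal_mult_left_mono) auto
  finally have "ereal (real d / sqrt 2) * ?D \<le> ereal (1 / sqrt 2) * diamond_norm d transpose_mat * ?D"
    using D0 by (intro ereal_mult_right_mono)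
  with bound show ?thesis by (meson order_trans)
qed

end
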